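(* Let $k\ge1$ be an integer and $0\le\alpha<1$. Every function $f(z)=zh(z)\overline{g(z)}\in S^{k*}_{LH}(\alpha)$ with $\omega(0)=0$, where $h(z)=\exp\left(\sum_{n\ge1}a_{nk}z^{nk}\right)$ and $g(z)=\exp\left(\sum_{n\ge1}b_{nk}z^{nk}\right)$, satisfies for any real $\theta$ the inequality $$|zf_{z}(z)|+|z|\exp\left(\sum_{n=1}^{\infty}\left|a_{nk}+e^{i\theta}b_{nk}\right||z|^{nk}\right)\le d(f(0),\partial f(\mathbb{D}))$$ for $|z|=r\le r_6$, where $r_6$ is the unique root in $(0,1)$ of the equation $$\frac{2^{\frac{2\alpha}{k}}\,r\left(2-(1+2\alpha)r^{k}+r^{2k}\right)}{(1-r^{k})^{\frac{2(\alpha+k)}{k}}}\exp\left(\frac{2(1-\alpha)(1+r^{k})}{k(1-r^{k})}\right)=1.$$ Here $r_6$ is the best possible.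
   Context: $\mathbb{D}=\{z\in\mathbb{C}:|z|<1\}$. A mapping $f$ on $\mathbb{D}$ is logharmonic if it solves $\overline{f_{\overline z}}/\overline{f}=\omega\, f_z/f$ for some analytic $\omega:\mathbb{D}\to\mathbb{C}$ with $|\omega|<1$, called the second dilatation of $f$. A mapping $f$ is $k$-fold symmetric if $f(e^{2\pi i/k}z)=e^{2\pi i/k}f(z)$. For an integer $k\ge1$ and $0\le\alpha<1$, $S^{k*}_{LH}(\alpha)$ is the class of univalent $k$-fold symmetric logharmonic mappings on $\mathbb{D}$ of the form $f(z)=zh(z)\overline{g(z)}$ with $h(z)=\exp\left(\sum_{n\ge1}a_{nk}z^{nk}\right)$ and $g(z)=\exp\left(\sum_{n\ge1}b_{nk}z^{nk}\right)$ analytic in $\mathbb{D}$, that are starlike of order $\alpha$: $\operatorname{Re}\left(\frac{zf_z(z)-\overline z f_{\overline z}(z)}{f(z)}\right)>\alpha$ for all $z\in\mathbb{D}$ (understood by its limit at $z=0$). $d$ is Euclidean distance in $\mathbb{C}$ and $\partial f(\mathbb{D})$ is the boundary of $f(\mathbb{D})$. "Best possible" means that $r_6$ cannot be replaced by a larger number so that the inequality still holds for all such $f$ and all real $\theta$. *)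

theory Defs
  imports "HOL-Complex_Analysis.Complex_Analysis"
begin

abbreviation unit_disc :: "complex set" where
  "unit_disc \<equiv> ball 0 1"

text \<open>Wirtinger derivatives, in terms of the real Frechet derivative:
  \<^term>\<open>frechet_derivative f (at z) 1\<close> and \<^term>\<open>frechet_derivative f (at z) \<i>\<close> are the partial
  derivatives with respect to the real and the imaginary part of the variable.\<close>

definition wirtinger_z :: "(complex \<Rightarrow> complex) \<Rightarrow> complex \<Rightarrow> complex" where
  "wirtinger_z f z =
     (frechet_derivative f (at z) 1 - \<i> * frechet_derivative f (at z) \<i>) / 2"

definition wirtinger_zbar :: "(complex \<Rightarrow> complex) \<Rightarrow> complex \<Rightarrow> complex" where
  "wirtinger_zbar f z =
     (frechet_derivative f (at z) 1 + \<i> * frechet_derivative f (at z) \<i>) / 2"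

text \<open>The quotients by \<^term>\<open>f z\<close> in the logharmonic equation are singular at zeros of \<^term>\<open>f\<close>, so the
  equation is imposed where \<^term>\<open>f z \<noteq> 0\<close>. For univalent \<^term>\<open>f\<close> this leaves out at most one
  point, and \<^term>\<open>\<omega>\<close> is determined there by continuity.\<close>

definition second_dilatation ::
    "(complex \<Rightarrow> complex) \<Rightarrow> (complex \<Rightarrow> complex) \<Rightarrow> bool" where
  "second_dilatation f \<omega> \<longleftrightarrow>
     \<omega> holomorphic_on unit_disc \<and>
     (\<forall>z\<in>unit_disc. norm (\<omega> z) < 1) \<and>
     (\<forall>z\<in>unit_disc. f z \<noteq> 0 \<longrightarrow>
        cnj (wirtinger_zbar f z) / cnj (f z) = \<omega> z * (wirtinger_z f z / f z))"

text \<open>Differentiability is only required off the zeros, since a general logharmonic mapping,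
  such as \<open>z * |z| powr (2 * \<beta>)\<close> with \<open>-1/2 < \<beta> < 0\<close>, may fail to be differentiable at a zero.\<close>

definition logharmonic :: "(complex \<Rightarrow> complex) \<Rightarrow> bool" where
  "logharmonic f \<longleftrightarrow>
     continuous_on unit_disc f \<and>
     (\<forall>z\<in>unit_disc. f z \<noteq> 0 \<longrightarrow> f differentiable (at z)) \<and>
     (\<exists>\<omega>. second_dilatation f \<omega>)"

definition fold_symmetric :: "nat \<Rightarrow> (complex \<Rightarrow> complex) \<Rightarrow> bool" where
  "fold_symmetric k f \<longleftrightarrow>
     (\<forall>z\<in>unit_disc.
        f (exp (2 * of_real pi * \<i> / of_nat k) * z) = exp (2 * of_real pi * \<i> / of_nat k) * f z)"

text \<open>At the origin, a zero of the mappings considered, the quotient is read as its limit.\<close>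

definition starlike_of_order :: "real \<Rightarrow> (complex \<Rightarrow> complex) \<Rightarrow> bool" where
  "starlike_of_order \<alpha> f \<longleftrightarrow>
     (let q = (\<lambda>z. (z * wirtinger_z f z - cnj z * wirtinger_zbar f z) / f z) in
        (\<forall>z\<in>unit_disc - {0}. Re (q z) > \<alpha>) \<and> (\<exists>l. (q \<longlongrightarrow> l) (at 0) \<and> Re l > \<alpha>))"

text \<open>Only the values \<open>c (n * k)\<close> with \<open>n \<ge> 1\<close> matter; the series below is indexed from
  \<^term>\<open>n = 0\<close>, hence \<^term>\<open>Suc n\<close>.\<close>

definition exp_lacunary_series ::
    "nat \<Rightarrow> (nat \<Rightarrow> complex) \<Rightarrow> (complex \<Rightarrow> complex) \<Rightarrow> bool" where
  "exp_lacunary_series k c h \<longleftrightarrow>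
     h holomorphic_on unit_disc \<and>
     (\<forall>z\<in>unit_disc. summable (\<lambda>n. c (Suc n * k) * z ^ (Suc n * k)) \<and>
        h z = exp (\<Sum>n. c (Suc n * k) * z ^ (Suc n * k)))"

definition logharmonic_representation ::
    "nat \<Rightarrow> (complex \<Rightarrow> complex) \<Rightarrow> (complex \<Rightarrow> complex) \<Rightarrow> (complex \<Rightarrow> complex) \<Rightarrow>
     (nat \<Rightarrow> complex) \<Rightarrow> (nat \<Rightarrow> complex) \<Rightarrow> bool" where
  "logharmonic_representation k f h g a b \<longleftrightarrow>
     exp_lacunary_series k a h \<and> exp_lacunary_series k b g \<and>
     (\<forall>z\<in>unit_disc. f z = z * h z * cnj (g z))"

definition starlike_logharmonic :: "nat \<Rightarrow> real \<Rightarrow> (complex \<Rightarrow> complex) set" where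
  "starlike_logharmonic k \<alpha> =
     {f. inj_on f unit_disc \<and> logharmonic f \<and> fold_symmetric k f \<and> starlike_of_order \<alpha> f \<and>
         (\<exists>h g a b. logharmonic_representation k f h g a b)}"

definition bohr_inequality ::
    "nat \<Rightarrow> (complex \<Rightarrow> complex) \<Rightarrow> (nat \<Rightarrow> complex) \<Rightarrow> (nat \<Rightarrow> complex) \<Rightarrow>
     real \<Rightarrow> complex \<Rightarrow> bool" where
  "bohr_inequality k f a b \<theta> z \<longleftrightarrow>
     norm (z * wirtinger_z f z)
       + norm z * exp (\<Sum>n. norm (a (Suc n * k) + exp (\<i> * of_real \<theta>) * b (Suc n * k))
                              * norm z ^ (Suc n * k))
     \<le> infdist (f 0) (frontier (f ` unit_disc))"

definition bohr_inequality_up_to :: "nat \<Rightarrow> real \<Rightarrow> real \<Rightarrow> bool" where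
  "bohr_inequality_up_to k \<alpha> \<rho> \<longleftrightarrow>
     (\<forall>f h g a b \<omega>.
        f \<in> starlike_logharmonic k \<alpha> \<and> logharmonic_representation k f h g a b \<and>
        second_dilatation f \<omega> \<and> \<omega> 0 = 0 \<longrightarrow>
        (\<forall>\<theta>. \<forall>z\<in>unit_disc. norm z \<le> \<rho> \<longrightarrow> bohr_inequality k f a b \<theta> z))"

definition radius_function :: "nat \<Rightarrow> real \<Rightarrow> real \<Rightarrow> real" where
  "radius_function k \<alpha> r =
     2 powr (2 * \<alpha> / real k) * r * (2 - (1 + 2 * \<alpha>) * r ^ k + r ^ (2 * k))
       / (1 - r ^ k) powr (2 * (\<alpha> + real k) / real k)
       * exp (2 * (1 - \<alpha>) * (1 + r ^ k) / (real k * (1 - r ^ k)))"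

end

theory Submission
  imports Defs
begin

text \<open>Put \<open>s = z ^ k\<close> and write \<open>h = exp (A s)\<close>, \<open>g = exp (B s)\<close>. Starlikeness says that
  \<open>p = 1 + k s A' - k s B'\<close> has real part greater than \<open>\<alpha>\<close>, and the dilatation is a Schwarz function
  \<open>W\<close> of \<open>s\<close>; with \<open>Q = (1 + W) / (1 - W)\<close> one has
  \<open>1 + k s A' + c k s B' = p (1 + (1 + c) / 2 (Q - 1))\<close>. Since \<open>p\<close> and \<open>Q\<close> are (up to normalisation)
  Caratheodory functions, the coefficient bound 2 yields all upper estimates at once.

  The lower bound for \<open>\<bar>f\<bar>\<close> is a bilinear statement in \<open>p\<close> and \<open>Q\<close>: two applications of the Poisson
  formula reduce it to Moebius transformations with parameters \<open>x\<close>, \<open>y\<close> of equal modulus, that is, to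
  \<open>Re ((x + y) / (x - y) (Ln (1 - y) - Ln (1 - x))) \<ge> -1\<close>, which follows from \<open>t cos t \<le> sin t\<close> because
  \<open>arg (1 - r e^{it}) - t / 2\<close> decreases in \<open>t\<close>.

  For sharpness one takes \<open>p = (1 + (1 - 2 \<alpha>) s) / (1 - s)\<close> and \<open>W = s\<close>. Its univalence comes from the
  logarithmic coordinate: the level sets of \<open>arg f\<close> are graphs along which \<open>\<bar>f\<bar>\<close> increases.\<close>

section \<open>Poisson averages and Caratheodory functions\<close>

text \<open>The lower bound for \<open>ln (norm (f z) / norm z)\<close> cannot come from a pointwise
  bound on the radial derivative: this is governed by \<open>Re (p * Q - 1)\<close>, and a product
  of two functions with positive real part may have real part of either sign. Only the integral
  along the radius is controlled. It is affine in \<open>P\<close> and in \<open>Q\<close>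
  separately, so one of them can be frozen while the other is averaged. The averages run over a
  circle of radius below 1, on which \<open>Re P\<close> and \<open>Re Q\<close> are continuous
  densities of mass 1; taking the same circle for both is what gives the two Moebius parameters
  equal modulus. The resulting bound,
  \<open>exp (-2 * (1 - \<alpha>) / k) * 2 powr (-2 * \<alpha> / k)\<close>, is the
  \<open>covering_radius\<close>. Its product with \<open>radius_function\<close> is
  \<open>bohr_majorant\<close>, the left-hand side of the inequality for the extremal mapping at
  \<open>z = r\<close>, \<open>\<theta> = 0\<close>. The equation for \<open>r\<^sub>6\<close> thus
  says that the worst left-hand side meets the least boundary distance.\<close>

lemma wirtinger_eqI:
  assumes "(f has_derivative (\<lambda>v. a * v + b * cnj v)) (at z)"
  shows "wirtinger_z f z = a" "wirtinger_zbar f z = b"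
proof -
  have "frechet_derivative f (at z) = (\<lambda>v. a * v + b * cnj v)"
    using frechet_derivative_at[OF assms] by simp
  then show "wirtinger_z f z = a" "wirtinger_zbar f z = b"
    by (simp_all add: wirtinger_z_def wirtinger_zbar_def field_simps)
qed

text \<open>The parameter interval is \<open>{0..1}\<close>, as for \<open>circlepath\<close>, so
  that plain integrals over it are circle means of total mass 1.\<close>

definition circ :: "real \<Rightarrow> real \<Rightarrow> complex" where
  "circ \<rho> s = of_real \<rho> * exp (2 * of_real pi * \<i> * of_real s)"

lemma norm_circ: "0 \<le> \<rho> \<Longrightarrow> norm (circ \<rho> s) = \<rho>"
  by (simp add: circ_def norm_mult)

lemma continuous_on_circ [continuous_intros]: "continuous_on S (circ \<rho>)"
  unfolding circ_def by (intro continuous_intros)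

lemma circlepath_circ: "circlepath 0 \<rho> = circ \<rho>"
  by (auto simp: circlepath circ_def fun_eq_iff mult_ac)

text \<open>The derivative of the path is 2 pi i times the path itself, which cancels the division
  by \<open>u\<close>.\<close>

lemma circ_contour_integral:
  assumes "((\<lambda>u. F u / u) has_contour_integral (2 * of_real pi * \<i> * I)) (circlepath 0 \<rho>)" "0 < \<rho>"
  shows "((\<lambda>s. F (circ \<rho> s)) has_integral I) {0..1}"
proof -
  have "((\<lambda>s. F (circ \<rho> s) / circ \<rho> s * vector_derivative (circlepath 0 \<rho>) (at s within {0..1}))
           has_integral (2 * of_real pi * \<i> * I)) {0..1}"
    using assms(1) unfolding has_contour_integral_def circlepath_circ .
  moreover have "F (circ \<rho> s) / circ \<rho> s * vector_derivative (circlepath 0 \<rho>) (at s within {0..1})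
       = 2 * of_real pi * \<i> * F (circ \<rho> s)" if "s \<in> {0..1}" for s
    using that assms(2) by (simp add: vector_derivative_circlepath01 circ_def field_simps)
  ultimately have "((\<lambda>s. 2 * of_real pi * \<i> * F (circ \<rho> s)) has_integral (2 * of_real pi * \<i> * I)) {0..1}"
    by (subst has_integral_cong[symmetric]) auto
  then show ?thesis
    by (subst (asm) has_integral_mult_right_iff) auto
qed

lemma circ_mean_value:
  assumes "F holomorphic_on cball 0 \<rho>" "0 < \<rho>"
  shows "((\<lambda>s. F (circ \<rho> s)) has_integral F 0) {0..1}"
  using Cauchy_integral_circlepath_simple[OF assms(1), of 0] assms(2)
  by (intro circ_contour_integral) auto

text \<open>On the circle \<open>\<rho>^2 = u * cnj u\<close>, so the integrand is the conjugate of
  \<open>F u * u / (\<rho>^2 - u * cnj w)\<close>. This is holomorphic on the closed disc because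
  \<open>norm w < \<rho>\<close>, and it vanishes at 0; the mean value property does the
  rest.\<close>

lemma circ_mean_cnj:
  assumes F: "F holomorphic_on cball 0 \<rho>" and \<rho>: "0 < \<rho>" and w: "norm w < \<rho>"
  shows "((\<lambda>s. cnj (F (circ \<rho> s)) / (circ \<rho> s - w)) has_integral 0) {0..1}"
proof -
  have ne: "of_real (\<rho>\<^sup>2) - u * cnj w \<noteq> 0" if "norm u \<le> \<rho>" for u
  proof
    assume "of_real (\<rho>\<^sup>2) - u * cnj w = 0"
    then have "norm (u * cnj w) = norm (of_real (\<rho>\<^sup>2) :: complex)"
      by simp
    then have "norm (u * cnj w) = \<rho>\<^sup>2"
      by (simp only: norm_of_real abs_power2)
    moreover have "norm u * norm w < \<rho> * \<rho>"
      using that w \<rho> 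
      by (meson less_le_trans mult_left_mono mult_right_mono mult_strict_left_mono norm_ge_zero order_le_less_trans)
    ultimately show False
      by (simp add: norm_mult power2_eq_square)
  qed
  have "((\<lambda>s. (\<lambda>u. F u * u / (of_real (\<rho>\<^sup>2) - u * cnj w)) (circ \<rho> s)) has_integral
         (\<lambda>u. F u * u / (of_real (\<rho>\<^sup>2) - u * cnj w)) 0) {0..1}"
    by (rule circ_mean_value) (use ne \<rho> in \<open>auto intro!: holomorphic_intros F\<close>)
  then have "((\<lambda>s. cnj (F (circ \<rho> s) * circ \<rho> s / (of_real (\<rho>\<^sup>2) - circ \<rho> s * cnj w))) has_integral
         cnj 0) {0..1}"
    by (subst (asm) has_integral_cnj[symmetric]) (simp add: o_def)
  moreover have "cnj (F (circ \<rho> s) * circ \<rho> s / (of_real (\<rho>\<^sup>2) - circ \<rho> s * cnj w))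
      = cnj (F (circ \<rho> s)) / (circ \<rho> s - w)" for s
  proof -
    have "of_real (\<rho>\<^sup>2) = circ \<rho> s * cnj (circ \<rho> s)"
      using norm_circ[of \<rho> s] \<rho> complex_norm_square[of "circ \<rho> s"] by simp
    then have "of_real (\<rho>\<^sup>2) - circ \<rho> s * cnj w = circ \<rho> s * cnj (circ \<rho> s - w)"
      by (simp add: algebra_simps)
    moreover have "circ \<rho> s \<noteq> 0" using \<rho> by (simp add: circ_def)
    ultimately show ?thesis by simp
  qed
  ultimately show ?thesis by simp
qed

text \<open>The Schwarz integral formula with its constant removed: the Herglotz kernel
  \<open>(u + w) / (u - w)\<close> minus 1, divided by \<open>w\<close>, is
  \<open>2 / (u - w)\<close>. Writing \<open>2 * Re P = cnj P + P\<close>, the conjugate part has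
  mean zero and Cauchy's formula evaluates the rest. Working with the quotient \<open>P1\<close>
  keeps the point \<open>w = 0\<close> regular.\<close>

lemma circ_poisson:
  assumes P1: "P1 holomorphic_on cball 0 \<rho>" and P: "\<And>w. P w = 1 + w * P1 w"
    and \<rho>: "0 < \<rho>" and w: "norm w < \<rho>"
  shows "((\<lambda>s. of_real (Re (P (circ \<rho> s))) * (2 / (circ \<rho> s - w))) has_integral P1 w) {0..1}"
proof -
  have hP: "P holomorphic_on cball 0 \<rho>"
    unfolding P by (intro holomorphic_intros P1)
  have ne: "circ \<rho> s - w \<noteq> 0" for s
    using norm_circ[of \<rho> s] \<rho> w by auto
  have 1: "((\<lambda>s. cnj (P (circ \<rho> s)) / (circ \<rho> s - w)) has_integral 0) {0..1}"
    by (rule circ_mean_cnj[OF hP \<rho> w])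
  have 2: "((\<lambda>s. 1 / (circ \<rho> s - w)) has_integral 0) {0..1}"
    using circ_mean_cnj[of "\<lambda>_. 1", OF _ \<rho> w] by simp
  have "((\<lambda>u. (u * P1 u / (u - w)) / u) has_contour_integral (2 * of_real pi * \<i> * P1 w)) (circlepath 0 \<rho>)"
  proof (rule has_contour_integral_eq)
    show "((\<lambda>u. P1 u / (u - w)) has_contour_integral (2 * of_real pi * \<i> * P1 w)) (circlepath 0 \<rho>)"
      using Cauchy_integral_circlepath_simple[OF P1, of w] w by simp
  qed (use \<rho> in auto)
  from circ_contour_integral[OF this \<rho>]
  have 3: "((\<lambda>s. circ \<rho> s * P1 (circ \<rho> s) / (circ \<rho> s - w)) has_integral P1 w) {0..1}" .
  have "of_real (Re (P u)) * (2 / v) = cnj (P u) / v + (1 / v + u * P1 u / v)" for u v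
  proof -
    have "2 * of_real (Re (P u)) = cnj (P u) + (1 + u * P1 u)"
      using complex_add_cnj[of "P u"] by (simp flip: P add: add.commute)
    then show ?thesis
      by (simp flip: add_divide_distrib add: mult.commute)
  qed
  then show ?thesis
    using has_integral_add[OF 1 has_integral_add[OF 2 3]] by simp
qed

definition caratheodory :: "(complex \<Rightarrow> complex) \<Rightarrow> bool" where
  "caratheodory P \<longleftrightarrow> P holomorphic_on unit_disc \<and> P 0 = 1 \<and> (\<forall>w\<in>unit_disc. 0 \<le> Re (P w))"

lemma caratheodory_quotient:
  assumes "caratheodory P"
  obtains P1 where "P1 holomorphic_on unit_disc" "\<And>w. P w = 1 + w * P1 w"
proof -
  define P1 where "P1 = (\<lambda>w. if w = 0 then deriv P 0 else (P w - P 0) / (w - 0))"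
  have "P1 holomorphic_on unit_disc"
    unfolding P1_def using assms by (intro pole_lemma_open) (auto simp: caratheodory_def)
  moreover have "P w = 1 + w * P1 w" for w
    using assms by (auto simp: P1_def caratheodory_def)
  ultimately show ?thesis
    using that by blast
qed

lemma cball_subset_unit_disc: "\<rho> < 1 \<Longrightarrow> cball 0 \<rho> \<subseteq> unit_disc"
  by (auto simp: subset_iff)

lemma caratheodory_mean:
  assumes P: "caratheodory P" and "0 < \<rho>" "\<rho> < 1"
  shows "((\<lambda>s. Re (P (circ \<rho> s))) has_integral 1) {0..1}"
proof -
  have "((\<lambda>s. P (circ \<rho> s)) has_integral P 0) {0..1}"
    using assms cball_subset_unit_disc
    by (intro circ_mean_value) (auto simp: caratheodory_def intro: holomorphic_on_subset)
  from has_integral_Re[OF this] show ?thesis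
    using P by (simp add: caratheodory_def)
qed

text \<open>For \<open>n > 0\<close> the term \<open>cnj P / u ^ n\<close> has mean zero, so the
  coefficient is also the mean of \<open>2 * Re P / u ^ n\<close>. As \<open>Re P\<close> is
  nonnegative with mean 1, the modulus is at most \<open>2 / \<rho> ^ n\<close>. Letting
  \<open>\<rho>\<close> tend to 1 then removes the radius.\<close>

lemma caratheodory_coeff_bound_aux:
  assumes P: "caratheodory P" and \<rho>: "0 < \<rho>" "\<rho> < 1" and n: "0 < n"
  shows "norm ((deriv ^^ n) P 0 / fact n) * \<rho> ^ n \<le> 2"
proof -
  define c where "c = (deriv ^^ n) P 0 / fact n"
  have hol: "P holomorphic_on cball 0 \<rho>"
    using P cball_subset_unit_disc[OF \<rho>(2)] by (auto simp: caratheodory_def intro: holomorphic_on_subset)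
  have "((\<lambda>u. P u / (u - 0) ^ Suc n) has_contour_integral ((2 * pi * \<i>) / fact n * (deriv ^^ n) P 0)) (circlepath 0 \<rho>)"
    using hol \<rho> by (intro Cauchy_has_contour_integral_higher_derivative_circlepath)
      (auto intro: holomorphic_on_imp_continuous_on holomorphic_on_subset)
  then have "((\<lambda>u. (P u / u ^ n) / u) has_contour_integral (2 * of_real pi * \<i> * c)) (circlepath 0 \<rho>)"
    by (simp add: c_def mult.commute)
  from circ_contour_integral[OF this \<rho>(1)]
  have 1: "((\<lambda>s. P (circ \<rho> s) / circ \<rho> s ^ n) has_integral c) {0..1}" .
  have "((\<lambda>s. P (circ \<rho> s) * circ \<rho> s ^ n) has_integral P 0 * 0 ^ n) {0..1}"
    by (rule circ_mean_value[where F = "\<lambda>u. P u * u ^ n"]) (auto intro!: holomorphic_intros hol \<rho>)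
  then have "((\<lambda>s. cnj (P (circ \<rho> s) * circ \<rho> s ^ n)) has_integral cnj 0) {0..1}"
    using n by (subst (asm) has_integral_cnj[symmetric]) (simp add: o_def power_0_left)
  from has_integral_divide[OF this, of "of_real (\<rho> ^ (2 * n))"]
  have 2: "((\<lambda>s. cnj (P (circ \<rho> s) * circ \<rho> s ^ n) / of_real (\<rho> ^ (2 * n))) has_integral 0) {0..1}"
    by simp
  have "cnj (P (circ \<rho> s) * circ \<rho> s ^ n) / of_real (\<rho> ^ (2 * n)) = cnj (P (circ \<rho> s)) / circ \<rho> s ^ n" for s
  proof -
    have "of_real (\<rho>\<^sup>2) = circ \<rho> s * cnj (circ \<rho> s)"
      using norm_circ[of \<rho> s] \<rho> complex_norm_square[of "circ \<rho> s"] by simp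
    then have "of_real (\<rho> ^ (2 * n)) = circ \<rho> s ^ n * cnj (circ \<rho> s ^ n)"
      by (metis complex_cnj_power of_real_power power_mult power_mult_distrib)
    moreover have "circ \<rho> s \<noteq> 0" using \<rho> by (simp add: circ_def)
    ultimately show ?thesis by simp
  qed
  then have "((\<lambda>s. P (circ \<rho> s) / circ \<rho> s ^ n + cnj (P (circ \<rho> s)) / circ \<rho> s ^ n) has_integral c) {0..1}"
    using has_integral_add[OF 1 2] by simp
  then have 3: "((\<lambda>s. of_real (2 * Re (P (circ \<rho> s))) / circ \<rho> s ^ n) has_integral c) {0..1}"
    by (simp only: add_divide_distrib[symmetric] complex_add_cnj)
  have 4: "((\<lambda>s. 2 * Re (P (circ \<rho> s)) / \<rho> ^ n) has_integral 2 * 1 / \<rho> ^ n) {0..1}"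
    by (intro has_integral_divide has_integral_mult_right caratheodory_mean P \<rho>)
  have "norm (integral {0..1} (\<lambda>s. of_real (2 * Re (P (circ \<rho> s))) / circ \<rho> s ^ n))
        \<le> integral {0..1} (\<lambda>s. 2 * Re (P (circ \<rho> s)) / \<rho> ^ n)"
  proof (rule integral_norm_bound_integral)
    fix s :: real assume "s \<in> {0..1}"
    have "0 \<le> Re (P (circ \<rho> s))"
      using P \<rho> norm_circ[of \<rho> s] by (auto simp: caratheodory_def)
    then show "norm (of_real (2 * Re (P (circ \<rho> s))) / circ \<rho> s ^ n) \<le> 2 * Re (P (circ \<rho> s)) / \<rho> ^ n"
      using \<rho> by (simp add: norm_divide norm_power norm_circ norm_mult)
  qed (use 3 4 in \<open>auto simp: has_integral_integrable\<close>)
  then have "norm c \<le> 2 * 1 / \<rho> ^ n"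
    by (simp only: integral_unique[OF 3] integral_unique[OF 4])
  then show ?thesis
    using \<rho> by (simp add: c_def[symmetric] pos_le_divide_eq)
qed

lemma caratheodory_coeff_bound:
  assumes P: "caratheodory P" and F: "P has_fps_expansion F" and n: "0 < n"
  shows "norm (fps_nth F n) \<le> 2"
proof -
  have "((\<lambda>\<rho>. norm (fps_nth F n) * \<rho> ^ n) \<longlongrightarrow> norm (fps_nth F n) * 1 ^ n) (at_left (1::real))"
    by (intro tendsto_intros)
  moreover have "\<forall>\<^sub>F \<rho> in at_left (1::real). norm (fps_nth F n) * \<rho> ^ n \<le> 2"
    using eventually_at_left_real[of 0 "1::real"]
    by (auto elim!: eventually_mono simp: fps_nth_fps_expansion[OF F]
        intro!: caratheodory_coeff_bound_aux P n)
  ultimately have "norm (fps_nth F n) * 1 ^ n \<le> 2"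
    by (rule tendsto_upperbound) simp
  then show ?thesis by simp
qed

text \<open>Reduction to Moebius kernels: \<open>P1 (t * z)\<close> is the average of
  \<open>2 / (\<xi> - t * z)\<close> over \<open>norm \<xi> = \<rho>\<close> with the probability
  density \<open>Re P\<close>. After exchanging the two integrals, a lower bound that holds for
  every single \<open>\<xi>\<close> survives averaging. The term \<open>B\<close> does not depend on
  \<open>\<xi>\<close>, so mass 1 reproduces it unchanged.\<close>

lemma caratheodory_average:
  assumes P: "caratheodory P" and P1: "P1 holomorphic_on unit_disc" "\<And>w. P w = 1 + w * P1 w"
    and z: "norm z < \<rho>" and \<rho>: "\<rho> < 1"
    and A: "continuous_on {0..1} A" and B: "continuous_on {0..1} B"
    and le: "\<And>\<xi>. norm \<xi> = \<rho> \<Longrightarrow>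
        m \<le> Re (integral {0..1} (\<lambda>t. 2 / (\<xi> - of_real t * z) * A t + B t))"
  shows "m \<le> Re (integral {0..1} (\<lambda>t. P1 (of_real t * z) * A t + B t))"
proof -
  define u where "u = (\<lambda>s. Re (P (circ \<rho> s)))"
  define J where "J = (\<lambda>s. integral {0..1} (\<lambda>t. 2 / (circ \<rho> s - of_real t * z) * A t + B t))"
  have \<rho>0: "0 < \<rho>" using z norm_ge_zero[of z] by linarith
  have P1': "P1 holomorphic_on cball 0 \<rho>"
    using P1(1) cball_subset_unit_disc[OF \<rho>] by (rule holomorphic_on_subset)
  have P': "P holomorphic_on cball 0 \<rho>"
    using P cball_subset_unit_disc[OF \<rho>] by (auto simp: caratheodory_def intro: holomorphic_on_subset)
  have tz: "norm (of_real t * z) < \<rho>" if "t \<in> {0..1}" for t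
    using that z mult_left_le_one_le[of "norm z" t] by (auto simp: norm_mult)
  have ne: "circ \<rho> s - of_real t * z \<noteq> 0" if "t \<in> {0..1}" for s t
    using norm_circ[of \<rho> s] \<rho>0 tz[OF that] by auto
  have u0: "0 \<le> u s" for s
    using P norm_circ[of \<rho> s] \<rho>0 \<rho> by (auto simp: u_def caratheodory_def)
  \<comment> \<open>Stated for an arbitrary continuous parameter \<open>g\<close>, because the
    density is needed both as a function of \<open>s\<close> and as a function of the pair
    \<open>(t, s)\<close>.\<close>
  have cPc: "continuous_on S (\<lambda>x. P (circ \<rho> (g x)))" if "continuous_on S g" for g :: "'c::topological_space \<Rightarrow> real" and S
  proof (rule continuous_on_compose2[OF holomorphic_on_imp_continuous_on[OF P']])
    show "continuous_on S (\<lambda>x. circ \<rho> (g x))"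
      by (rule continuous_on_compose2[OF continuous_on_circ that]) auto
  qed (use \<rho>0 in \<open>auto simp: norm_circ\<close>)
  have cu: "continuous_on S (\<lambda>x. u (g x))" if "continuous_on S g" for g :: "'c::topological_space \<Rightarrow> real" and S
    unfolding u_def by (intro continuous_intros cPc that)
  have u1: "(u has_integral 1) {0..1}"
    unfolding u_def using P \<rho>0 \<rho> by (rule caratheodory_mean)
  have cK: "continuous_on (cbox (0, 0) (1, 1)) (\<lambda>(t, s). of_real (u s) * (2 / (circ \<rho> s - of_real t * z) * A t + B t))"
    unfolding split_def cbox_Pair_eq
    by (intro continuous_intros cu continuous_on_compose2[OF A] continuous_on_compose2[OF B]
         continuous_on_compose2[OF continuous_on_circ[of UNIV]])
       (use ne in auto)
  have swap: "integral {0..1} (\<lambda>t. integral {0..1} (\<lambda>s. of_real (u s) * (2 / (circ \<rho> s - of_real t * z) * A t + B t)))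
      = integral {0..1} (\<lambda>s. integral {0..1} (\<lambda>t. of_real (u s) * (2 / (circ \<rho> s - of_real t * z) * A t + B t)))"
    using integral_swap_continuous[OF cK] by simp
  have inner: "integral {0..1} (\<lambda>s. of_real (u s) * (2 / (circ \<rho> s - of_real t * z) * A t + B t))
       = P1 (of_real t * z) * A t + B t" if "t \<in> {0..1}" for t
  proof -
    have "((\<lambda>s. of_real (u s) * (2 / (circ \<rho> s - of_real t * z)) * A t + of_real (u s) * B t)
            has_integral (P1 (of_real t * z) * A t + of_real 1 * B t)) {0..1}"
      unfolding u_def
      by (intro has_integral_add has_integral_mult_left circ_poisson[OF P1' P1(2) \<rho>0 tz[OF that]]
          has_integral_of_real caratheodory_mean P \<rho>0 \<rho>)
    then show ?thesis
      by (simp add: integral_unique algebra_simps)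
  qed
  have "continuous_on ({0..1} \<times> cbox 0 1) (\<lambda>(s, t). 2 / (circ \<rho> s - of_real t * z) * A t + B t)"
    unfolding split_def
    by (intro continuous_intros continuous_on_compose2[OF A] continuous_on_compose2[OF B]
         continuous_on_compose2[OF continuous_on_circ[of UNIV]])
       (use ne in auto)
  from integral_continuous_on_param[OF this]
  have cJ: "continuous_on {0..1} J"
    by (simp add: J_def)
  have "integral {0..1} (\<lambda>t. P1 (of_real t * z) * A t + B t)
      = integral {0..1} (\<lambda>t. integral {0..1} (\<lambda>s. of_real (u s) * (2 / (circ \<rho> s - of_real t * z) * A t + B t)))"
    by (rule integral_cong) (simp only: inner)
  also note swap
  finally have "integral {0..1} (\<lambda>t. P1 (of_real t * z) * A t + B t) = integral {0..1} (\<lambda>s. of_real (u s) * J s)"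
    by (simp only: J_def integral_mult_right)
  moreover have "((\<lambda>s. of_real (u s) * J s) has_integral integral {0..1} (\<lambda>s. of_real (u s) * J s)) {0..1}"
    by (intro integrable_integral integrable_continuous_real continuous_intros cJ cu)
  from has_integral_Re[OF this]
  have "((\<lambda>s. u s * Re (J s)) has_integral Re (integral {0..1} (\<lambda>s. of_real (u s) * J s))) {0..1}"
    by simp
  moreover have "((\<lambda>s. u s * m) has_integral 1 * m) {0..1}"
    by (intro has_integral_mult_left u1)
  moreover have "u s * m \<le> u s * Re (J s)" for s
    unfolding J_def using \<rho>0 by (intro mult_left_mono le u0) (auto simp: norm_circ)
  ultimately show ?thesis
    using has_integral_le[of "\<lambda>s. u s * m" "1 * m" "{0..1}" "\<lambda>s. u s * Re (J s)"] by simp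
qed

section \<open>The kernel of the lower bound\<close>

lemma Re_div_one_minus:
  assumes "norm w < 1"
  shows "-1/2 < Re (w / (1 - w))"
proof -
  have 1: "1 - w \<noteq> 0" using assms by auto
  have "w / (1 - w) = 1 / (1 - w) - 1"
    using 1 by (simp add: field_simps)
  moreover have "1/2 < Re (1 / (1 - w))"
  proof -
    have w2: "(Re w)\<^sup>2 + (Im w)\<^sup>2 < 1"
      using assms by (simp add: cmod_def)
    have "0 < (norm (1 - w))\<^sup>2" using 1 by simp
    then have d: "0 < (1 - Re w)\<^sup>2 + (Im w)\<^sup>2" by (simp add: cmod_power2)
    have "Re (1 / (1 - w)) = (1 - Re w) / ((1 - Re w)\<^sup>2 + (Im w)\<^sup>2)"
      by (simp add: Re_divide)
    also have "1/2 < \<dots>"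
      using d w2 by (simp add: field_simps power2_eq_square)
    finally show ?thesis .
  qed
  ultimately show ?thesis by simp
qed

text \<open>With \<open>w = r * exp (i t)\<close>, the argument of \<open>1 - w\<close> has
  derivative \<open>- Re (w / (1 - w))\<close>, which is below 1/2. The slope 1/2 is the limiting
  one: on the unit circle the argument of \<open>1 - exp (i t)\<close> is
  \<open>(t - pi) / 2\<close> for \<open>0 < t < 2 pi\<close>.\<close>

lemma Im_Ln_antimono:
  assumes r: "0 \<le> r" "r < 1" and "s \<le> t"
  shows "Im (Ln (1 - of_real r * exp (\<i> * of_real t))) - t / 2
       \<le> Im (Ln (1 - of_real r * exp (\<i> * of_real s))) - s / 2"
proof -
  define w where "w = (\<lambda>t. of_real r * exp (\<i> * of_real t) :: complex)"
  have nw: "norm (w t) < 1" for t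
    using r by (simp add: w_def norm_mult)
  have nn: "1 - w t \<notin> \<real>\<^sub>\<le>\<^sub>0" for t
    using nw[of t] abs_Re_le_cmod[of "w t"] by (auto simp: complex_nonpos_Reals_iff)
  have der: "((\<lambda>t. Im (Ln (1 - w t)) - t / 2) has_real_derivative
      (- Re (w t / (1 - w t)) - 1/2)) (at t)" for t
  proof -
    have w': "(w has_vector_derivative (\<i> * w t)) (at t)"
      unfolding w_def by (auto intro!: derivative_eq_intros has_vector_derivative_real_field)
    have "((\<lambda>t. 1 - w t) has_vector_derivative (- (\<i> * w t))) (at t)"
      using has_vector_derivative_diff[OF has_vector_derivative_const w', of 1] by simp
    from field_vector_diff_chain_at[OF this has_field_derivative_Ln[OF nn]]
    have "((\<lambda>t. Ln (1 - w t)) has_vector_derivative (- (\<i> * w t) * inverse (1 - w t))) (at t)"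
      by (simp add: o_def)
    then have "((\<lambda>t. Im (Ln (1 - w t))) has_vector_derivative Im (- (\<i> * w t) * inverse (1 - w t))) (at t)"
      by (rule bounded_linear.has_vector_derivative[OF bounded_linear_Im])
    also have "- (\<i> * w t) * inverse (1 - w t) = - \<i> * (w t / (1 - w t))"
      by (simp add: divide_inverse)
    also have "Im (- \<i> * (w t / (1 - w t))) = - Re (w t / (1 - w t))"
      by (simp del: times_divide_eq_right)
    finally have "((\<lambda>t. Im (Ln (1 - w t))) has_real_derivative - Re (w t / (1 - w t))) (at t)"
      by (simp add: has_real_derivative_iff_has_vector_derivative)
    then show ?thesis
      by (rule DERIV_diff) (auto intro!: derivative_eq_intros)
  qed
  have "Im (Ln (1 - w t)) - t / 2 \<le> Im (Ln (1 - w s)) - s / 2"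
  proof (rule DERIV_nonpos_imp_nonincreasing[OF \<open>s \<le> t\<close>])
    fix x
    show "\<exists>y. ((\<lambda>t. Im (Ln (1 - w t)) - t / 2) has_real_derivative y) (at x) \<and> y \<le> 0"
      using der[of x] Re_div_one_minus[OF nw[of x]] by (intro exI conjI) auto
  qed
  then show ?thesis by (simp add: w_def)
qed

lemma mult_cos_le_sin:
  assumes "0 \<le> t" "t \<le> pi / 2"
  shows "t * cos t \<le> sin t"
proof (cases "t = pi/2")
  case False
  then have "t < pi/2" using assms by simp
  then have "\<bar>t\<bar> \<le> \<bar>tan t\<bar>" "0 < cos t"
    using assms abs_tan_ge[of t] cos_gt_zero_pi[of t] by auto
  moreover have "0 \<le> tan t"
    using \<open>0 < cos t\<close> sin_ge_zero[of t] assms by (simp add: tan_def)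
  ultimately show ?thesis
    using assms by (simp add: tan_def field_simps)
next
  \<comment> \<open>Here \<open>tan\<close> would divide by zero, so the endpoint is evaluated
    directly.\<close>
  case True
  then show ?thesis unfolding True by simp
qed

text \<open>Rotating both points to \<open>cis (\<delta>/2)\<close> and
  \<open>cis (-\<delta>/2)\<close> turns the quotient into \<open>- \<i> * cot (\<delta>/2)\<close>.
  Hence only the imaginary part of the difference of logarithms counts; it is at least
  \<open>-\<delta>/2\<close>, and \<open>(\<delta>/2) * cot (\<delta>/2) \<le> 1\<close>.\<close>

lemma kernel_bound_aux:
  assumes r: "0 < r" "r < 1" and \<delta>: "0 < \<delta>" "\<delta> \<le> pi"
    and x: "x = of_real r * exp (\<i> * of_real (\<theta> + \<delta>))" and y: "y = of_real r * exp (\<i> * of_real \<theta>)"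
  shows "-1 \<le> Re ((x + y) / (x - y) * (Ln (1 - y) - Ln (1 - x)))"
proof -
  define D where "D = Ln (1 - y) - Ln (1 - x)"
  define c where "c = cos (\<delta>/2) / sin (\<delta>/2)"
  have s: "0 < sin (\<delta>/2)" using \<delta> by (intro sin_gt_zero) auto
  have c0: "0 \<le> c" unfolding c_def using \<delta> s by (intro divide_nonneg_pos cos_ge_zero) auto
  have x': "x = of_real r * exp (\<i> * of_real (\<theta> + \<delta>/2)) * cis (\<delta>/2)"
    by (simp add: x cis_conv_exp exp_add[symmetric] algebra_simps)
  have y': "y = of_real r * exp (\<i> * of_real (\<theta> + \<delta>/2)) * cis (-\<delta>/2)"
    by (simp add: y cis_conv_exp exp_add[symmetric] algebra_simps)
  have "(x + y) / (x - y) = (cis (\<delta>/2) + cis (-\<delta>/2)) / (cis (\<delta>/2) - cis (-\<delta>/2))"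
    unfolding x' y' ring_distribs[symmetric] right_diff_distrib[symmetric] using r by simp
  also have "\<dots> = - \<i> * of_real c"
  proof -
    have "cis (\<delta>/2) + cis (-\<delta>/2) = of_real (2 * cos (\<delta>/2))"
         "cis (\<delta>/2) - cis (-\<delta>/2) = \<i> * of_real (2 * sin (\<delta>/2))"
      by (simp_all add: complex_eq_iff)
    then show ?thesis
      using s by (simp only: c_def) (simp add: field_simps)
  qed
  finally have "Re ((x + y) / (x - y) * D) = c * Im D" by simp
  moreover have "-\<delta>/2 \<le> Im D"
    using Im_Ln_antimono[of r \<theta> "\<theta> + \<delta>"] r \<delta> by (simp add: x y D_def add_divide_distrib)
  then have "c * (-\<delta>/2) \<le> c * Im D" using c0 by (intro mult_left_mono) auto
  moreover have "c * (\<delta>/2) \<le> 1"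
    using mult_cos_le_sin[of "\<delta>/2"] \<delta> s by (simp add: c_def field_simps)
  ultimately show ?thesis by (simp add: D_def)
qed

text \<open>Exchanging \<open>x\<close> and \<open>y\<close> flips the sign of both factors, so the
  expression is symmetric and the angle from \<open>y\<close> to \<open>x\<close> may be taken
  positive. It is not zero, since distinct points of equal modulus have different arguments.\<close>

lemma kernel_bound:
  assumes "norm x = norm y" "norm y < 1" "x \<noteq> y"
  shows "-1 \<le> Re ((x + y) / (x - y) * (Ln (1 - y) - Ln (1 - x)))"
proof -
  have *: "-1 \<le> Re ((x + y) / (x - y) * (Ln (1 - y) - Ln (1 - x)))"
    if n: "norm x = norm y" "norm y < 1" "x \<noteq> y" and a: "0 < Arg (x / y)" for x y
  proof (rule kernel_bound_aux[where r = "norm y" and \<delta> = "Arg (x / y)" and \<theta> = "Arg y"])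
    have y: "y \<noteq> 0" using n by auto
    then have x: "x / y \<noteq> 0" using n by auto
    have "norm (x / y) = 1" using n y by (simp add: norm_divide)
    then have "x / y = exp (\<i> * of_real (Arg (x / y)))"
      using Arg_eq[OF x] by simp
    moreover have y': "y = of_real (norm y) * exp (\<i> * of_real (Arg y))"
      using Arg_eq[OF y] by simp
    moreover have "x = y * (x / y)" using y by simp
    ultimately show "x = of_real (norm y) * exp (\<i> * of_real (Arg y + Arg (x / y)))"
      by (metis (no_types, lifting) distrib_left exp_add mult.assoc of_real_add)
    show "y = of_real (norm y) * exp (\<i> * of_real (Arg y))" by (fact y')
  qed (use n a Arg_le_pi in auto)
  have y: "y \<noteq> 0" using assms by auto
  have xy: "x / y \<noteq> 0" using assms y by auto
  show ?thesis
  proof (cases "0 < Arg (x / y)")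
    case True
    then show ?thesis using * assms by blast
  next
    case False
    have "Arg (x / y) \<noteq> 0"
    proof
      assume "Arg (x / y) = 0"
      moreover have "norm (x / y) = 1" using assms y by (simp add: norm_divide)
      ultimately have "x / y = 1" using Arg_eq[OF xy] by simp
      then show False using assms y by simp
    qed
    then have neg: "Arg (x / y) < 0" using False by simp
    have "Arg (inverse (x / y)) = - Arg (x / y)"
      using Arg_inverse[of "x / y"] neg Arg_real[of "x / y"] pi_gt_zero by (auto split: if_splits)
    then have "0 < Arg (y / x)" using neg by simp
    from *[OF _ _ _ this] assms
    have "-1 \<le> Re ((y + x) / (y - x) * (Ln (1 - x) - Ln (1 - y)))" by simp
    also have "(y + x) / (y - x) * (Ln (1 - x) - Ln (1 - y)) = (x + y) / (x - y) * (Ln (1 - y) - Ln (1 - x))"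
    proof -
      have "y - x = - (x - y)" "Ln (1 - x) - Ln (1 - y) = - (Ln (1 - y) - Ln (1 - x))" by simp_all
      then show ?thesis by (simp only: divide_minus_right minus_mult_minus) (simp add: add.commute)
    qed
    finally show ?thesis .
  qed
qed

text \<open>The first summand integrates to \<open>- Ln (1 - y)\<close>, and
  \<open>norm (1 - y) \<le> 2\<close> yields the \<open>ln 2\<close>. The second is split by partial
  fractions into logarithms, giving \<open>kernel_bound\<close>; for \<open>x = y\<close> its
  confluent form \<open>2 * x / (1 - x)\<close> appears instead. Both bounds become equalities in
  the limit \<open>x = y = -1\<close>, which points to the extremal mapping.\<close>

lemma kernel_integral_bound:
  assumes "norm x = norm y" "norm y < 1" and \<alpha>: "0 \<le> \<alpha>" "\<alpha> \<le> 1"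
  shows "-2 * (1 - \<alpha>) - 2 * \<alpha> * ln 2
    \<le> Re (integral {0..1} (\<lambda>t. of_real (2 * \<alpha>) * (y / (1 - of_real t * y))
              + of_real (2 * (1 - \<alpha>)) * ((x + y) / ((1 - of_real t * x) * (1 - of_real t * y)))))"
proof -
  have tn: "norm (of_real t * w) < 1" if "t \<in> {0..1}" "norm w < 1" for t and w :: complex
    using that mult_left_le_one_le[of "norm w" t] by (auto simp: norm_mult)
  have nn: "1 - of_real t * w \<notin> \<real>\<^sub>\<le>\<^sub>0" if "t \<in> {0..1}" "norm w < 1" for t and w :: complex
    using tn[OF that] abs_Re_le_cmod[of "of_real t * w"] by (auto simp: complex_nonpos_Reals_iff)
  have ne: "1 - of_real t * w \<noteq> 0" if "t \<in> {0..1}" "norm w < 1" for t and w :: complex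
    using tn[OF that] by auto
  have log: "((\<lambda>t. w / (1 - of_real t * w)) has_integral - Ln (1 - w)) {0..1}" if w: "norm w < 1" for w
  proof -
    have "((\<lambda>t. w / (1 - of_real t * w)) has_integral (- Ln (1 - of_real 1 * w)) - (- Ln (1 - of_real 0 * w))) {0..1}"
    proof (rule fundamental_theorem_of_calculus)
      fix t :: real assume t: "t \<in> {0..1}"
      show "((\<lambda>t. - Ln (1 - of_real t * w)) has_vector_derivative w / (1 - of_real t * w)) (at t within {0..1})"
        using nn[OF t w] ne[OF t w]
        by (intro has_vector_derivative_real_field) (auto intro!: derivative_eq_intros simp: field_simps)
    qed simp
    then show ?thesis by simp
  qed
  have x: "norm x < 1" using assms by simp
  obtain L where L: "((\<lambda>t. (x + y) / ((1 - of_real t * x) * (1 - of_real t * y))) has_integral L) {0..1}" "-1 \<le> Re L"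
  proof (cases "x = y")
    case True
    have "((\<lambda>t. (x + y) / ((1 - of_real t * x) * (1 - of_real t * y))) has_integral
       2 * of_real 1 * x / (1 - of_real 1 * x) - 2 * of_real 0 * x / (1 - of_real 0 * x)) {0..1}"
    proof (rule fundamental_theorem_of_calculus)
      fix t :: real assume t: "t \<in> {0..1}"
      show "((\<lambda>t. 2 * of_real t * x / (1 - of_real t * x)) has_vector_derivative
          (x + y) / ((1 - of_real t * x) * (1 - of_real t * y))) (at t within {0..1})"
        using ne[OF t x] True
        by (intro has_vector_derivative_real_field) (auto intro!: derivative_eq_intros simp: field_simps)
    qed simp
    moreover have "-1 \<le> Re (2 * x / (1 - x))"
      using Re_div_one_minus[OF x] by (simp flip: times_divide_eq_right)
    ultimately show ?thesis using that by simp
  next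
    case False
    have eq: "(x + y) / ((1 - of_real t * x) * (1 - of_real t * y))
       = (x + y) / (x - y) * (x / (1 - of_real t * x) - y / (1 - of_real t * y))" if "t \<in> {0..1}" for t
    proof -
      have "x / (1 - of_real t * x) - y / (1 - of_real t * y)
         = (x - y) / ((1 - of_real t * x) * (1 - of_real t * y))"
        using ne[OF that x] ne[OF that assms(2)] by (simp add: divide_simps) (simp add: algebra_simps)
      then show ?thesis using False by simp
    qed
    have "((\<lambda>t. (x + y) / (x - y) * (x / (1 - of_real t * x) - y / (1 - of_real t * y))) has_integral
       (x + y) / (x - y) * (- Ln (1 - x) - (- Ln (1 - y)))) {0..1}"
      by (intro has_integral_mult_right has_integral_diff log assms x)
    then have "((\<lambda>t. (x + y) / ((1 - of_real t * x) * (1 - of_real t * y))) has_integral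
       (x + y) / (x - y) * (Ln (1 - y) - Ln (1 - x))) {0..1}"
      by (rule has_integral_eq_rhs[OF has_integral_eq, rotated]) (auto simp: eq)
    then show ?thesis using that kernel_bound[OF assms(1,2) False] by blast
  qed
  have "((\<lambda>t. of_real (2 * \<alpha>) * (y / (1 - of_real t * y))
              + of_real (2 * (1 - \<alpha>)) * ((x + y) / ((1 - of_real t * x) * (1 - of_real t * y))))
        has_integral of_real (2 * \<alpha>) * (- Ln (1 - y)) + of_real (2 * (1 - \<alpha>)) * L) {0..1}"
    by (intro has_integral_add has_integral_mult_right log assms L)
  then have eq: "Re (integral {0..1} (\<lambda>t. of_real (2 * \<alpha>) * (y / (1 - of_real t * y))
              + of_real (2 * (1 - \<alpha>)) * ((x + y) / ((1 - of_real t * x) * (1 - of_real t * y)))))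
      = - 2 * \<alpha> * Re (Ln (1 - y)) + 2 * (1 - \<alpha>) * Re L"
    by (subst integral_unique) auto
  have "1 - y \<noteq> 0" using assms(2) by auto
  then have "Re (Ln (1 - y)) = ln (norm (1 - y))" "0 < norm (1 - y)" by auto
  moreover have "norm (1 - y) \<le> 2" using norm_triangle_ineq4[of 1 y] assms(2) by simp
  ultimately have "Re (Ln (1 - y)) \<le> ln 2" by simp
  then have "2 * \<alpha> * Re (Ln (1 - y)) \<le> 2 * \<alpha> * ln 2" using \<alpha> by (intro mult_left_mono) auto
  moreover have "2 * (1 - \<alpha>) * (-1) \<le> 2 * (1 - \<alpha>) * Re L"
    using \<alpha> L(2) by (intro mult_left_mono) auto
  ultimately show ?thesis unfolding eq by simp
qed

section \<open>Products of Caratheodory functions\<close>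

lemma caratheodory_norm_bound:
  assumes P: "caratheodory P" and w: "norm w < 1"
  shows "norm (P w) \<le> (1 + norm w) / (1 - norm w)"
proof -
  define F where "F = fps_expansion P 0"
  have hol: "P holomorphic_on eball 0 1" and F: "P has_fps_expansion F"
    using P unfolding F_def by (auto simp: caratheodory_def one_ereal_def intro!: has_fps_expansion_fps_expansion[of unit_disc])
  have sums: "(\<lambda>n. fps_nth F n * w ^ n) sums P w"
    using has_fps_expansion_imp_sums_complex[OF F hol] w by (simp add: one_ereal_def)
  \<comment> \<open>The correction at \<open>n = 0\<close> lowers the majorant of the constant term
    from 2 to the actual value 1.\<close>
  have "(\<lambda>n. (if n = 0 then -1 else 0) + 2 * norm w ^ n) sums (-1 + 2 * (1 / (1 - norm w)))"
    using w by (intro sums_add sums_mult geometric_sums) (auto intro: sums_single)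
  moreover have "norm (fps_nth F n * w ^ n) \<le> (if n = 0 then -1 else 0) + 2 * norm w ^ n" for n
  proof (cases "n = 0")
    case True
    have "fps_nth F 0 = 1"
      using fps_nth_fps_expansion[OF F, of 0] P by (simp add: caratheodory_def)
    then show ?thesis using True by simp
  next
    case False
    then show ?thesis
      using caratheodory_coeff_bound[OF P F, of n] by (auto simp: norm_mult norm_power intro: mult_right_mono)
  qed
  ultimately have "norm (\<Sum>n. fps_nth F n * w ^ n) \<le> -1 + 2 * (1 / (1 - norm w))"
    using norm_suminf_le[of "\<lambda>n. fps_nth F n * w ^ n" "\<lambda>n. (if n = 0 then -1 else 0) + 2 * norm w ^ n"]
    by (simp only: sums_iff)
  then have "norm (P w) \<le> -1 + 2 * (1 / (1 - norm w))"
    using sums by (simp only: sums_iff)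
  also have "\<dots> = (1 + norm w) / (1 - norm w)"
    using w by (simp add: field_simps)
  finally show ?thesis .
qed

lemma caratheodory_cayley:
  assumes hol: "W holomorphic_on unit_disc" and W: "\<And>w. w \<in> unit_disc \<Longrightarrow> norm (W w) < 1" and "W 0 = 0"
  shows "caratheodory (\<lambda>w. (1 + W w) / (1 - W w))"
proof -
  have ne: "1 - W w \<noteq> 0" if "w \<in> unit_disc" for w
    using W[OF that] by auto
  have "0 \<le> Re ((1 + W w) / (1 - W w))" if "w \<in> unit_disc" for w
  proof -
    have "(1 + W w) / (1 - W w) = 1 + 2 * (W w / (1 - W w))"
      using ne[OF that] by (simp add: field_simps)
    then show ?thesis
      using Re_div_one_minus[OF W[OF that]] by (simp flip: times_divide_eq_right)
  qed
  then show ?thesis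
    unfolding caratheodory_def using ne assms by (auto intro!: holomorphic_intros)
qed

text \<open>With \<open>w = t * z\<close> and \<open>p = 1 + (1 - \<alpha>) * w * P1 w\<close>, the
  integrand is \<open>(p * Q - 1) / t\<close>. The averaging lemma is applied to \<open>P\<close>
  with \<open>Q\<close> kept, then to \<open>Q\<close> with the point \<open>\<xi>\<close> kept,
  leaving an integral that depends on two points of one circle.\<close>

lemma product_integral_bound:
  assumes P: "caratheodory P" and P1: "P1 holomorphic_on unit_disc" "\<And>w. P w = 1 + w * P1 w"
    and Q: "caratheodory Q" and Q1: "Q1 holomorphic_on unit_disc" "\<And>w. Q w = 1 + w * Q1 w"
    and z: "norm z < 1" and \<alpha>: "0 \<le> \<alpha>" "\<alpha> \<le> 1"
  shows "-2 * (1 - \<alpha>) - 2 * \<alpha> * ln 2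
    \<le> Re (integral {0..1} (\<lambda>t. P1 (of_real t * z) * (of_real (1 - \<alpha>) * z * Q (of_real t * z)) + z * Q1 (of_real t * z)))"
proof -
  obtain \<rho> where \<rho>: "norm z < \<rho>" "\<rho> < 1" using z dense by blast
  have \<rho>0: "0 < \<rho>" using \<rho> norm_ge_zero[of z] by linarith
  have tz: "norm (of_real t * z) < \<rho>" if "t \<in> {0..1}" for t
    using that \<rho> mult_left_le_one_le[of "norm z" t] by (auto simp: norm_mult)
  have ne: "\<xi> - of_real t * z \<noteq> 0" if "norm \<xi> = \<rho>" "t \<in> {0..1}" for \<xi> t
    using tz[OF that(2)] that(1) by auto
  have cont: "continuous_on {0..1} (\<lambda>t. f (of_real t * z))" if "f holomorphic_on unit_disc" for f
    by (rule continuous_on_compose2[OF holomorphic_on_imp_continuous_on[OF that]])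
       (use less_trans[OF tz \<rho>(2)] in \<open>auto intro!: continuous_intros\<close>)
  have cQ: "Q holomorphic_on unit_disc" using Q by (simp add: caratheodory_def)
  show ?thesis
  proof (rule caratheodory_average[OF P P1 \<rho>])
    show "continuous_on {0..1} (\<lambda>t. of_real (1 - \<alpha>) * z * Q (of_real t * z))"
      by (intro continuous_intros cont cQ)
    show "continuous_on {0..1} (\<lambda>t. z * Q1 (of_real t * z))"
      by (intro continuous_intros cont Q1)
    fix \<xi> :: complex assume \<xi>: "norm \<xi> = \<rho>"
    \<comment> \<open>Inserting \<open>Q = 1 + w * Q1\<close> makes the integrand affine in
      \<open>Q1\<close>, the form required for the second averaging.\<close>
    have eq1: "2 / (\<xi> - of_real t * z) * (of_real (1 - \<alpha>) * z * Q (of_real t * z)) + z * Q1 (of_real t * z)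
       = Q1 (of_real t * z) * (z + 2 * of_real (1 - \<alpha>) * of_real t * z\<^sup>2 / (\<xi> - of_real t * z))
          + 2 * of_real (1 - \<alpha>) * z / (\<xi> - of_real t * z)" if "t \<in> {0..1}" for t
      by (simp add: Q1(2) divide_inverse algebra_simps power2_eq_square)
    have "-2 * (1 - \<alpha>) - 2 * \<alpha> * ln 2 \<le> Re (integral {0..1}
      (\<lambda>t. Q1 (of_real t * z) * (z + 2 * of_real (1 - \<alpha>) * of_real t * z\<^sup>2 / (\<xi> - of_real t * z))
          + 2 * of_real (1 - \<alpha>) * z / (\<xi> - of_real t * z)))"
    proof (rule caratheodory_average[OF Q Q1 \<rho>])
      show "continuous_on {0..1} (\<lambda>t. z + 2 * of_real (1 - \<alpha>) * of_real t * z\<^sup>2 / (\<xi> - of_real t * z))"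
        using ne[OF \<xi>] by (intro continuous_intros) auto
      show "continuous_on {0..1} (\<lambda>t. 2 * of_real (1 - \<alpha>) * z / (\<xi> - of_real t * z))"
        using ne[OF \<xi>] by (intro continuous_intros) auto
      fix \<eta> :: complex assume \<eta>: "norm \<eta> = \<rho>"
      \<comment> \<open>Since \<open>\<xi>\<close> and \<open>\<eta>\<close> lie on the same circle
        outside \<open>z\<close>, the parameters \<open>x\<close> and \<open>y\<close> have equal
        modulus below 1.\<close>
      define x where "x = z / \<xi>"
      define y where "y = z / \<eta>"
      have nz: "\<xi> \<noteq> 0" "\<eta> \<noteq> 0" using \<xi> \<eta> \<rho>0 by auto
      have "2 / (\<eta> - of_real t * z) * (z + 2 * of_real (1 - \<alpha>) * of_real t * z\<^sup>2 / (\<xi> - of_real t * z))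
          + 2 * of_real (1 - \<alpha>) * z / (\<xi> - of_real t * z)
          = of_real (2 * \<alpha>) * (y / (1 - of_real t * y))
              + of_real (2 * (1 - \<alpha>)) * ((x + y) / ((1 - of_real t * x) * (1 - of_real t * y)))"
        if t: "t \<in> {0..1}" for t
      proof -
        define u where "u = 1 - of_real t * x"
        define v where "v = 1 - of_real t * y"
        have u: "\<xi> - of_real t * z = \<xi> * u" and v: "\<eta> - of_real t * z = \<eta> * v"
          using nz by (simp_all add: u_def v_def x_def y_def algebra_simps)
        have uv: "u \<noteq> 0" "v \<noteq> 0" using ne[OF \<xi> t] ne[OF \<eta> t] u v by auto
        have z: "z = \<xi> * x" "z = \<eta> * y" using nz by (auto simp: x_def y_def)
        have "2 / (\<eta> - of_real t * z) * (z + 2 * of_real (1 - \<alpha>) * of_real t * z\<^sup>2 / (\<xi> - of_real t * z))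
          + 2 * of_real (1 - \<alpha>) * z / (\<xi> - of_real t * z)
          = 2 * (z / \<eta>) / v * (1 + 2 * of_real (1 - \<alpha>) * of_real t * (z / \<xi>) / u) + 2 * of_real (1 - \<alpha>) * (z / \<xi>) / u"
          unfolding u v using nz uv by (simp add: divide_simps power2_eq_square) (simp add: algebra_simps)
        also have "\<dots> = 2 * y / v * (1 + 2 * of_real (1 - \<alpha>) * of_real t * x / u) + 2 * of_real (1 - \<alpha>) * x / u"
          by (simp add: x_def y_def)
        \<comment> \<open>The summand \<open>2 * y / v\<close> is split in the ratio
          \<open>\<alpha> : 1 - \<alpha>\<close>; in the second part
          \<open>y * u + 2 * t * x * y + x * v\<close> collapses to \<open>x + y\<close>.\<close>
        also have "\<dots> = of_real (2 * \<alpha>) * (y / v) + of_real (2 * (1 - \<alpha>)) * ((x + y) / (u * v))"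
          using uv by (simp add: divide_simps) (simp add: u_def v_def algebra_simps)
        finally show ?thesis by (simp add: u_def v_def)
      qed
      then have "integral {0..1} (\<lambda>t. 2 / (\<eta> - of_real t * z) * (z + 2 * of_real (1 - \<alpha>) * of_real t * z\<^sup>2 / (\<xi> - of_real t * z))
          + 2 * of_real (1 - \<alpha>) * z / (\<xi> - of_real t * z))
        = integral {0..1} (\<lambda>t. of_real (2 * \<alpha>) * (y / (1 - of_real t * y))
              + of_real (2 * (1 - \<alpha>)) * ((x + y) / ((1 - of_real t * x) * (1 - of_real t * y))))"
        by (rule integral_cong)
      moreover have "norm x = norm y" "norm y < 1"
        using \<xi> \<eta> \<rho> \<rho>0 by (auto simp: x_def y_def norm_divide)
      ultimately show "-2 * (1 - \<alpha>) - 2 * \<alpha> * ln 2 \<le> Re (integral {0..1}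
          (\<lambda>t. 2 / (\<eta> - of_real t * z) * (z + 2 * of_real (1 - \<alpha>) * of_real t * z\<^sup>2 / (\<xi> - of_real t * z))
          + 2 * of_real (1 - \<alpha>) * z / (\<xi> - of_real t * z)))"
        using kernel_integral_bound[of x y \<alpha>] \<alpha> by simp
    qed
    also have "integral {0..1}
      (\<lambda>t. Q1 (of_real t * z) * (z + 2 * of_real (1 - \<alpha>) * of_real t * z\<^sup>2 / (\<xi> - of_real t * z))
          + 2 * of_real (1 - \<alpha>) * z / (\<xi> - of_real t * z))
      = integral {0..1} (\<lambda>t. 2 / (\<xi> - of_real t * z) * (of_real (1 - \<alpha>) * z * Q (of_real t * z)) + z * Q1 (of_real t * z))"
      by (rule integral_cong) (simp only: eq1)
    finally show "-2 * (1 - \<alpha>) - 2 * \<alpha> * ln 2 \<le> Re (integral {0..1}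
       (\<lambda>t. 2 / (\<xi> - of_real t * z) * (of_real (1 - \<alpha>) * z * Q (of_real t * z)) + z * Q1 (of_real t * z)))" .
  qed
qed

section \<open>Logarithms of the two factors\<close>

text \<open>All data are functions of \<open>s = z ^ k\<close>, and the mapping itself enters only
  later. The same estimates then serve an arbitrary member of the class and the extremal mapping.
  The dilatation in the variable \<open>z\<close> is \<open>W (z ^ k)\<close>, and its equation is
  written without quotients.\<close>

locale starlike_logarithms =
  fixes k :: nat and \<alpha> :: real and A B W :: "complex \<Rightarrow> complex"
  assumes k: "1 \<le> k" and \<alpha>: "0 \<le> \<alpha>" "\<alpha> < 1"
    and A: "A holomorphic_on unit_disc" "A 0 = 0" and B: "B holomorphic_on unit_disc" "B 0 = 0"
    and W: "W holomorphic_on unit_disc" "W 0 = 0" and W1: "\<And>s. s \<in> unit_disc \<Longrightarrow> norm (W s) < 1"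
    and dilatation: "\<And>s. s \<in> unit_disc \<Longrightarrow>
      of_nat k * s * deriv B s = W s * (1 + of_nat k * s * deriv A s)"
    and starlike: "\<And>s. s \<in> unit_disc \<Longrightarrow>
      \<alpha> < Re (1 + of_nat k * s * deriv A s - of_nat k * s * deriv B s)"
begin

definition p :: "complex \<Rightarrow> complex" where
  "p s = 1 + of_nat k * s * deriv A s - of_nat k * s * deriv B s"

definition P :: "complex \<Rightarrow> complex" where
  "P s = (p s - of_real \<alpha>) / of_real (1 - \<alpha>)"

definition Q :: "complex \<Rightarrow> complex" where
  "Q s = (1 + W s) / (1 - W s)"

lemma deriv_hol [holomorphic_intros]: "deriv A holomorphic_on unit_disc" "deriv B holomorphic_on unit_disc"
  by (auto intro!: holomorphic_deriv A B)

lemma caratheodory_P: "caratheodory P"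
  unfolding caratheodory_def
proof (intro conjI ballI)
  show "P holomorphic_on unit_disc"
    unfolding P_def p_def using \<alpha> by (intro holomorphic_intros) auto
  show "P 0 = 1"
    using \<alpha> by (simp add: P_def p_def)
  show "0 \<le> Re (P s)" if "s \<in> unit_disc" for s
    unfolding P_def Re_divide_of_real using starlike[OF that] \<alpha> by (simp add: p_def)
qed

lemma p_conv_P: "p s = of_real \<alpha> + of_real (1 - \<alpha>) * P s"
  using \<alpha> by (simp add: P_def)

lemma caratheodory_Q: "caratheodory Q"
  unfolding Q_def using W W1 by (intro caratheodory_cayley) auto

lemma one_minus_W: "s \<in> unit_disc \<Longrightarrow> 1 - W s \<noteq> 0"
  using W1[of s] by auto

lemma p_W: "s \<in> unit_disc \<Longrightarrow> p s = (1 - W s) * (1 + of_nat k * s * deriv A s)"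
  using dilatation[of s] by (simp add: p_def algebra_simps)

text \<open>Both distortion quantities are products of functions with positive real part,
  because \<open>W / (1 - W) = (Q - 1) / 2\<close>.\<close>

lemma combination_eq:
  assumes "s \<in> unit_disc"
  shows "1 + of_nat k * s * deriv A s + c * (of_nat k * s * deriv B s) = p s * (1 + (1 + c) / 2 * (Q s - 1))"
proof -
  have "1 + (1 + c) / 2 * (Q s - 1) = (1 + c * W s) / (1 - W s)"
    using one_minus_W[OF assms] by (simp add: Q_def divide_simps) (simp add: algebra_simps)
  then have "p s * (1 + (1 + c) / 2 * (Q s - 1)) = (1 + of_nat k * s * deriv A s) * (1 + c * W s)"
    using one_minus_W[OF assms] by (simp add: p_W[OF assms])
  then show ?thesis
    using dilatation[OF assms] by (simp add: algebra_simps)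
qed

text \<open>The quantity is \<open>p / (1 - W)\<close>: the numerator is bounded through
  \<open>P\<close>, the denominator by the Schwarz lemma
  \<open>norm (W s) \<le> norm s\<close>.\<close>

lemma norm_one_plus_deriv_le:
  assumes s: "norm s < 1"
  shows "norm (1 + of_nat k * s * deriv A s) \<le> (1 + (1 - 2 * \<alpha>) * norm s) / (1 - norm s)\<^sup>2"
proof -
  have s': "s \<in> unit_disc" using s by simp
  have "norm (W s) \<le> norm s"
    using W W1 s by (intro Schwarz_Lemma) auto
  then have W': "1 - norm s \<le> norm (1 - W s)"
    using norm_triangle_ineq2[of 1 "W s"] by simp
  have "norm (p s) \<le> norm (of_real \<alpha> :: complex) + norm (of_real (1 - \<alpha>) * P s)"
    unfolding p_conv_P by (rule norm_triangle_ineq)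
  also have "\<dots> = \<alpha> + (1 - \<alpha>) * norm (P s)"
    using \<alpha> by (simp only: norm_mult norm_of_real abs_of_nonneg)
  also have "\<dots> \<le> \<alpha> + (1 - \<alpha>) * ((1 + norm s) / (1 - norm s))"
    using \<alpha> caratheodory_norm_bound[OF caratheodory_P s] by (intro add_left_mono mult_left_mono) auto
  also have "\<dots> = (1 + (1 - 2 * \<alpha>) * norm s) / (1 - norm s)"
    using s by (simp add: field_simps)
  finally have p: "norm (p s) \<le> (1 + (1 - 2 * \<alpha>) * norm s) / (1 - norm s)" .
  have "norm (1 + of_nat k * s * deriv A s) = norm (p s) / norm (1 - W s)"
    using one_minus_W[OF s'] by (simp add: p_W[OF s'] norm_mult)
  also have "\<dots> \<le> ((1 + (1 - 2 * \<alpha>) * norm s) / (1 - norm s)) / (1 - norm s)"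
    using p W' s by (intro frac_le) (auto intro: order_trans[OF norm_ge_zero p])
  finally show ?thesis by (simp add: power2_eq_square)
qed

text \<open>By \<open>combination_eq\<close>, \<open>n * k\<close> times the combination is the n-th
  coefficient of a product of two series with constant term 1, whose other coefficients are at most
  \<open>2 * (1 - \<alpha>)\<close> and 2. The convolution has two end terms and
  \<open>n - 1\<close> mixed ones, and \<open>2 + 2 * (1 - \<alpha>) + 4 * (1 - \<alpha>) * (n - 1)
  = 4 * (1 - \<alpha>) * n + 2 * \<alpha>\<close>. Uniformity in \<open>c\<close> comes from
  \<open>norm ((1 + c) / 2) \<le> 1\<close>.\<close>

lemma coeff_bound:
  assumes FA: "A has_fps_expansion FA" and FB: "B has_fps_expansion FB"
    and c: "norm c = 1" and n: "0 < n"
  shows "norm (fps_nth FA n + c * fps_nth FB n) \<le> (4 * (1 - \<alpha>) + 2 * \<alpha> / n) / k"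
proof -
  define \<mu> where "\<mu> = (1 + c) / 2"
  have \<mu>: "norm \<mu> \<le> 1"
    using norm_triangle_ineq[of 1 c] c by (simp add: \<mu>_def norm_divide)
  define FP where "FP = fps_expansion P 0"
  define FQ where "FQ = fps_expansion Q 0"
  have FP: "P has_fps_expansion FP" and FQ: "Q has_fps_expansion FQ"
    using caratheodory_P caratheodory_Q unfolding FP_def FQ_def caratheodory_def
    by (auto intro!: has_fps_expansion_fps_expansion[of unit_disc])
  have P0: "fps_nth FP 0 = 1" and Q0: "fps_nth FQ 0 = 1"
    using caratheodory_P caratheodory_Q by (simp_all add: fps_nth_fps_expansion[OF FP] fps_nth_fps_expansion[OF FQ] caratheodory_def)
  define Fp where "Fp = fps_const (of_real \<alpha>) + fps_const (of_real (1 - \<alpha>)) * FP"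
  define Fq where "Fq = 1 + fps_const \<mu> * (FQ - 1)"
  have "(\<lambda>s. p s * (1 + \<mu> * (Q s - 1))) has_fps_expansion Fp * Fq"
    unfolding Fp_def Fq_def p_conv_P by (intro fps_expansion_intros FP FQ)
  moreover have "\<forall>\<^sub>F s in nhds 0. p s * (1 + \<mu> * (Q s - 1))
      = 1 + of_nat k * s * deriv A s + c * (of_nat k * s * deriv B s)"
    using eventually_nhds_in_open[of unit_disc 0] by (auto elim!: eventually_mono simp: combination_eq \<mu>_def)
  ultimately have "(\<lambda>s. 1 + of_nat k * s * deriv A s + c * (of_nat k * s * deriv B s)) has_fps_expansion Fp * Fq"
    by (subst (asm) has_fps_expansion_cong) auto
  moreover have "(\<lambda>s. 1 + of_nat k * s * deriv A s + c * (of_nat k * s * deriv B s)) has_fps_expansion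
      1 + fps_const (of_nat k) * fps_X * fps_deriv FA + fps_const c * (fps_const (of_nat k) * fps_X * fps_deriv FB)"
    by (intro fps_expansion_intros FA FB)
  ultimately have eq: "Fp * Fq = 1 + fps_const (of_nat k) * fps_X * fps_deriv FA
      + fps_const c * (fps_const (of_nat k) * fps_X * fps_deriv FB)"
    by (rule fps_expansion_unique_complex)
  have "of_nat (n * k) * (fps_nth FA n + c * fps_nth FB n) = fps_nth (Fp * Fq) n"
    unfolding eq using n by (cases n) (simp_all add: mult.assoc algebra_simps)
  also have "\<dots> = (\<Sum>i\<le>n. fps_nth Fp i * fps_nth Fq (n - i))"
    by (simp add: fps_mult_nth atMost_atLeast0)
  finally have eq': "of_nat (n * k) * (fps_nth FA n + c * fps_nth FB n) = \<dots>" .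
  have Fp0: "fps_nth Fp 0 = 1" and Fq0: "fps_nth Fq 0 = 1"
    by (simp_all add: Fp_def Fq_def P0 Q0)
  have Fp: "norm (fps_nth Fp i) \<le> 2 * (1 - \<alpha>)" if "0 < i" for i
  proof -
    have "fps_nth Fp i = of_real (1 - \<alpha>) * fps_nth FP i"
      using that by (simp add: Fp_def)
    then have "norm (fps_nth Fp i) = (1 - \<alpha>) * norm (fps_nth FP i)"
      using \<alpha> by (simp only: norm_mult norm_of_real abs_of_nonneg)
    also have "\<dots> \<le> (1 - \<alpha>) * 2"
      using \<alpha> caratheodory_coeff_bound[OF caratheodory_P FP that] by (intro mult_left_mono) auto
    finally show ?thesis by simp
  qed
  have Fq: "norm (fps_nth Fq i) \<le> 2" if "0 < i" for i
  proof -
    have "norm (fps_nth Fq i) = norm \<mu> * norm (fps_nth FQ i)"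
      using that by (simp add: Fq_def norm_mult)
    also have "\<dots> \<le> 1 * 2"
      using \<mu> caratheodory_coeff_bound[OF caratheodory_Q FQ that] by (intro mult_mono) auto
    finally show ?thesis by simp
  qed
  obtain m where m: "n = Suc m" using n by (cases n) auto
  have "(\<Sum>i\<le>n. fps_nth Fp i * fps_nth Fq (n - i)) = fps_nth Fp 0 * fps_nth Fq n
     + (\<Sum>i<m. fps_nth Fp (Suc i) * fps_nth Fq (m - i)) + fps_nth Fp n * fps_nth Fq 0"
    unfolding m sum.atMost_Suc by (subst sum.atMost_shift) (simp add: algebra_simps)
  also have "norm \<dots> \<le> 2 + (\<Sum>i<m. 2 * (1 - \<alpha>) * 2) + 2 * (1 - \<alpha>)"
  proof (intro norm_triangle_le add_mono sum_norm_le)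
    fix i assume "i \<in> {..<m}"
    then show "norm (fps_nth Fp (Suc i) * fps_nth Fq (m - i)) \<le> 2 * (1 - \<alpha>) * 2"
      unfolding norm_mult using \<alpha> by (intro mult_mono Fp Fq) auto
  qed (use Fp[OF n] Fq[OF n] in \<open>simp_all add: Fp0 Fq0\<close>)
  also have "\<dots> = n * (4 * (1 - \<alpha>) + 2 * \<alpha> / n)"
    by (simp add: m field_simps)
  finally have "norm (of_nat (n * k) * (fps_nth FA n + c * fps_nth FB n)) \<le> n * (4 * (1 - \<alpha>) + 2 * \<alpha> / n)"
    unfolding eq' .
  then have "real n * (k * norm (fps_nth FA n + c * fps_nth FB n)) \<le> n * (4 * (1 - \<alpha>) + 2 * \<alpha> / n)"
    by (simp only: norm_mult norm_of_nat of_nat_mult mult.assoc)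
  then have "k * norm (fps_nth FA n + c * fps_nth FB n) \<le> 4 * (1 - \<alpha>) + 2 * \<alpha> / n"
    using n by (subst (asm) mult_le_cancel_left_pos) auto
  then show ?thesis
    using k by (simp add: field_simps)
qed

text \<open>\<open>k * (A + B)\<close> is the integral of its derivative along the segment from 0 to
  \<open>s\<close>; \<open>combination_eq\<close> with \<open>c = 1\<close> identifies that
  derivative with the integrand of \<open>product_integral_bound\<close>.\<close>

lemma Re_sum_ge:
  assumes s: "norm s < 1"
  shows "(- 2 * (1 - \<alpha>) - 2 * \<alpha> * ln 2) / k \<le> Re (A s + B s)"
proof -
  obtain P1 where P1: "P1 holomorphic_on unit_disc" "\<And>w. P w = 1 + w * P1 w"
    using caratheodory_quotient[OF caratheodory_P] by blast
  obtain Q1 where Q1: "Q1 holomorphic_on unit_disc" "\<And>w. Q w = 1 + w * Q1 w"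
    using caratheodory_quotient[OF caratheodory_Q] by blast
  have ts: "of_real t * s \<in> unit_disc" if "t \<in> {0..1}" for t
    using that s mult_left_le_one_le[of "norm s" t] by (auto simp: norm_mult)
  have "((\<lambda>t. of_nat k * (s * (deriv A (of_real t * s) + deriv B (of_real t * s)))) has_integral
     of_nat k * ((A (of_real 1 * s) + B (of_real 1 * s)) - (A (of_real 0 * s) + B (of_real 0 * s)))) {0..1}"
  proof (intro has_integral_mult_right fundamental_theorem_of_calculus)
    fix t :: real assume t: "t \<in> {0..1}"
    have d: "(A has_field_derivative deriv A (of_real t * s)) (at (of_real t * s))"
         "(B has_field_derivative deriv B (of_real t * s)) (at (of_real t * s))"
      using A B ts[OF t] by (auto intro!: holomorphic_derivI[of _ unit_disc])
    have "((\<lambda>t. A (t * s) + B (t * s)) has_field_derivative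
        s * (deriv A (of_real t * s) + deriv B (of_real t * s))) (at (of_real t))"
      by (auto intro!: derivative_eq_intros DERIV_chain2[where g = "\<lambda>t. t * s", OF d(1)]
          DERIV_chain2[where g = "\<lambda>t. t * s", OF d(2)] simp: algebra_simps)
    then show "((\<lambda>t. A (of_real t * s) + B (of_real t * s)) has_vector_derivative
         s * (deriv A (of_real t * s) + deriv B (of_real t * s))) (at t within {0..1})"
      by (rule has_vector_derivative_real_field)
  qed simp
  then have int: "((\<lambda>t. of_nat k * (s * (deriv A (of_real t * s) + deriv B (of_real t * s)))) has_integral
     of_nat k * (A s + B s)) {0..1}"
    using A B by simp
  \<comment> \<open>The comparison cancels a factor \<open>t\<close>, so it is made off
    \<open>t = 0\<close>; a single point does not affect the integral.\<close>
  have eq: "P1 (of_real t * s) * (of_real (1 - \<alpha>) * s * Q (of_real t * s)) + s * Q1 (of_real t * s)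
      = of_nat k * (s * (deriv A (of_real t * s) + deriv B (of_real t * s)))" if "t \<in> {0..1} - {0}" for t
  proof -
    define w where "w = of_real t * s"
    have w: "w \<in> unit_disc" using ts[of t] that by (simp add: w_def)
    have "1 + of_nat k * w * (deriv A w + deriv B w) = (1 + of_real (1 - \<alpha>) * (w * P1 w)) * Q w"
      using combination_eq[OF w, of 1] p_conv_P[of w] P1(2)[of w] by (simp add: algebra_simps)
    also have "\<dots> = 1 + w * (of_real (1 - \<alpha>) * P1 w * Q w + Q1 w)"
      by (simp add: distrib_right) (simp add: Q1(2) algebra_simps)
    finally have "of_real t * (of_nat k * (s * (deriv A w + deriv B w)))
        = of_real t * (s * (of_real (1 - \<alpha>) * P1 w * Q w + Q1 w))"
      by (simp add: w_def algebra_simps)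
    then have "of_nat k * (s * (deriv A w + deriv B w)) = s * (of_real (1 - \<alpha>) * P1 w * Q w + Q1 w)"
      using that by simp
    then show ?thesis
      unfolding w_def[symmetric] by (simp add: algebra_simps)
  qed
  have "((\<lambda>t. P1 (of_real t * s) * (of_real (1 - \<alpha>) * s * Q (of_real t * s)) + s * Q1 (of_real t * s))
      has_integral of_nat k * (A s + B s)) {0..1}"
    by (rule has_integral_spike_finite[where S = "{0}", OF _ eq int]) simp_all
  then have "- 2 * (1 - \<alpha>) - 2 * \<alpha> * ln 2 \<le> Re (of_nat k * (A s + B s))"
    using product_integral_bound[OF caratheodory_P P1 caratheodory_Q Q1 s \<alpha>(1) less_imp_le[OF \<alpha>(2)]]
    by (simp only: integral_unique)
  then show ?thesis
    using k by (simp add: field_simps)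
qed

end

section \<open>From logharmonic mappings to their logarithms\<close>

lemma root_in_unit_disc:
  assumes "1 \<le> k" "s \<in> unit_disc"
  obtains z where "z \<in> unit_disc" "z ^ k = s"
proof -
  obtain z where z: "s = z ^ k"
    using exists_complex_root[of k s] assms by auto
  then have "norm z ^ k < 1"
    using assms by (simp add: norm_power)
  then have "norm z < 1"
    using assms by (simp add: power_less_one_iff)
  then show ?thesis using that z by simp
qed

lemma power_in_unit_disc: "1 \<le> k \<Longrightarrow> z \<in> unit_disc \<Longrightarrow> z ^ k \<in> unit_disc"
  for z :: complex
  by (simp add: norm_power power_less_one_iff)

text \<open>Convergence is given only at points \<open>z ^ k\<close>, but these exhaust the disc.
  The sums therefore form a power series in \<open>s\<close>, with constant term fixed to 0.\<close>

lemma exp_lacunary_seriesE: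
  assumes h: "exp_lacunary_series k c h" and k: "1 \<le> k"
  obtains A F where "A holomorphic_on unit_disc" "A 0 = 0" "A has_fps_expansion F"
    "\<And>n. fps_nth F (Suc n) = c (Suc n * k)"
    "\<And>z. z \<in> unit_disc \<Longrightarrow> h z = exp (A (z ^ k))"
proof -
  define A where "A = (\<lambda>s. \<Sum>n. c (Suc n * k) * s ^ Suc n)"
  define F where "F = Abs_fps (\<lambda>n. if n = 0 then 0 else c (n * k))"
  have pow: "z ^ (Suc n * k) = (z ^ k) ^ Suc n" for z :: complex and n
    by (metis power_mult mult.commute)
  have "summable (\<lambda>n. c (Suc n * k) * s ^ Suc n)" if s: "s \<in> unit_disc" for s
  proof -
    obtain z where "z \<in> unit_disc" "z ^ k = s"
      using root_in_unit_disc[OF k s] .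
    then show ?thesis
      using h unfolding exp_lacunary_series_def pow by auto
  qed
  then have "(\<lambda>n. fps_nth F (Suc n) * s ^ Suc n) sums A s" if "s \<in> unit_disc" for s
    using that unfolding A_def F_def by (auto intro: summable_sums)
  then have sums: "(\<lambda>n. fps_nth F n * s ^ n) sums A s" if "s \<in> unit_disc" for s
    using that by (subst (asm) sums_Suc_iff) (simp add: F_def)
  have "A holomorphic_on unit_disc"
    by (rule power_series_holomorphic[where a = "fps_nth F"]) (use sums in auto)
  moreover have "A 0 = 0"
    by (simp add: A_def)
  moreover have "A has_fps_expansion F"
    by (rule has_fps_expansionI) (use sums eventually_nhds_in_open[of unit_disc 0] in \<open>auto elim!: eventually_mono\<close>)
  moreover have "fps_nth F (Suc n) = c (Suc n * k)" for n
    by (simp add: F_def)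
  moreover have "h z = exp (A (z ^ k))" if "z \<in> unit_disc" for z
    using h that unfolding exp_lacunary_series_def A_def pow by blast
  ultimately show ?thesis using that by blast
qed

definition exp_form ::
    "nat \<Rightarrow> (complex \<Rightarrow> complex) \<Rightarrow> (complex \<Rightarrow> complex) \<Rightarrow> (complex \<Rightarrow> complex) \<Rightarrow> bool" where
  "exp_form k A B f \<longleftrightarrow>
     (\<forall>z\<in>unit_disc. f z = z * exp (A (z ^ k)) * cnj (exp (B (z ^ k))))"

lemma exp_formD:
  "exp_form k A B f \<Longrightarrow> z \<in> unit_disc \<Longrightarrow> f z = z * exp (A (z ^ k)) * cnj (exp (B (z ^ k)))"
  by (simp add: exp_form_def)

text \<open>A holomorphic times an antiholomorphic factor has a derivative of the form
  \<open>a * v + b * cnj v\<close>. Multiplying by \<open>z\<close> turns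
  \<open>k * z ^ (k - 1)\<close> into \<open>k * z ^ k\<close>, so the logarithmic derivatives
  depend on \<open>s\<close> alone and the formulas also hold at the origin.\<close>

lemma wirtinger_exp_form:
  assumes k: "1 \<le> k" and A: "A holomorphic_on unit_disc" and B: "B holomorphic_on unit_disc"
    and f: "exp_form k A B f"
    and z: "z \<in> unit_disc"
  shows "f differentiable (at z)"
    and "z * wirtinger_z f z = f z * (1 + of_nat k * z ^ k * deriv A (z ^ k))"
    and "cnj z * wirtinger_zbar f z = f z * cnj (of_nat k * z ^ k * deriv B (z ^ k))"
proof -
  have zk: "z ^ k \<in> unit_disc" using power_in_unit_disc[OF k z] .
  define a where "a = deriv A (z ^ k) * (of_nat k * z ^ (k - 1))"
  define b where "b = deriv B (z ^ k) * (of_nat k * z ^ (k - 1))"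
  have dA: "((\<lambda>z. A (z ^ k)) has_field_derivative a) (at z)"
    unfolding a_def
    by (rule DERIV_chain2[where f = A and g = "\<lambda>z. z ^ k"])
       (use holomorphic_derivI[OF A _ zk] in \<open>auto intro!: derivative_eq_intros\<close>)
  have dB: "((\<lambda>z. B (z ^ k)) has_field_derivative b) (at z)"
    unfolding b_def
    by (rule DERIV_chain2[where f = B and g = "\<lambda>z. z ^ k"])
       (use holomorphic_derivI[OF B _ zk] in \<open>auto intro!: derivative_eq_intros\<close>)
  define H where "H = exp (A (z ^ k))"
  define G where "G = exp (B (z ^ k))"
  have 1: "((\<lambda>z. z * exp (A (z ^ k))) has_derivative (*) (H * (1 + z * a))) (at z)"
    unfolding has_field_derivative_def[symmetric] H_def
    by (auto intro!: derivative_eq_intros dA simp: algebra_simps)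
  have "((\<lambda>z. exp (B (z ^ k))) has_derivative (*) (G * b)) (at z)"
    unfolding has_field_derivative_def[symmetric] G_def
    by (auto intro!: derivative_eq_intros dB)
  then have 2: "((\<lambda>z. cnj (exp (B (z ^ k)))) has_derivative (\<lambda>v. cnj (G * b * v))) (at z)"
    by (rule bounded_linear.has_derivative[OF bounded_linear_cnj])
  have "((\<lambda>z. z * exp (A (z ^ k)) * cnj (exp (B (z ^ k)))) has_derivative
      (\<lambda>v. (H * (1 + z * a) * cnj G) * v + (z * H * cnj (G * b)) * cnj v)) (at z)"
    by (rule has_derivative_eq_rhs[OF has_derivative_mult[OF 1 2]]) (auto simp: H_def G_def algebra_simps)
  then have d: "(f has_derivative
      (\<lambda>v. (H * (1 + z * a) * cnj G) * v + (z * H * cnj (G * b)) * cnj v)) (at z)"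
    by (rule has_derivative_transform_within_open[OF _ _ z]) (auto simp: exp_formD[OF f])
  show "f differentiable (at z)"
    using d unfolding differentiable_def by blast
  have za: "z * a = of_nat k * z ^ k * deriv A (z ^ k)" and zb: "z * b = of_nat k * z ^ k * deriv B (z ^ k)"
    using k by (cases k; simp add: a_def b_def)+
  have fz: "f z = z * H * cnj G"
    by (simp add: exp_formD[OF f z] H_def G_def)
  show "z * wirtinger_z f z = f z * (1 + of_nat k * z ^ k * deriv A (z ^ k))"
    unfolding wirtinger_eqI(1)[OF d] fz za[symmetric] by simp
  show "cnj z * wirtinger_zbar f z = f z * cnj (of_nat k * z ^ k * deriv B (z ^ k))"
    unfolding wirtinger_eqI(2)[OF d] fz zb[symmetric] by simp
qed

text \<open>The given dilatation is a function of \<open>z\<close> and has to descend to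
  \<open>s\<close>. The quotient of the two logarithmic derivatives does so directly, and evaluating
  the logharmonic equation at any k-th root of \<open>s\<close> bounds it by 1.\<close>

lemma starlike_logarithmsI:
  assumes k: "1 \<le> k" and \<alpha>: "0 \<le> \<alpha>" "\<alpha> < 1"
    and A: "A holomorphic_on unit_disc" "A 0 = 0" and B: "B holomorphic_on unit_disc" "B 0 = 0"
    and f: "exp_form k A B f"
    and \<omega>: "second_dilatation f \<omega>" and star: "starlike_of_order \<alpha> f"
  shows "starlike_logarithms k \<alpha> A B
     (\<lambda>s. of_nat k * s * deriv B s / (1 + of_nat k * s * deriv A s))"
proof -
  define pA where "pA = (\<lambda>s. 1 + of_nat k * s * deriv A s)"
  define pB where "pB = (\<lambda>s. of_nat k * s * deriv B s)"
  note wf = wirtinger_exp_form[OF k A(1) B(1) f]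
  have *: "\<alpha> < Re (pA s - pB s)" "\<exists>z\<in>unit_disc. pB s = \<omega> z * pA s" if s: "s \<in> unit_disc" "s \<noteq> 0" for s
  proof -
    obtain z where z: "z \<in> unit_disc" and zk: "z ^ k = s"
      using root_in_unit_disc[OF k s(1)] .
    have z0: "z \<noteq> 0" using zk s k by (auto simp: power_0_left)
    have fz: "f z \<noteq> 0" using z0 by (simp add: exp_formD[OF f z])
    have 1: "z * wirtinger_z f z = f z * pA s" and 2: "cnj z * wirtinger_zbar f z = f z * cnj (pB s)"
      using wf(2,3)[OF z] by (simp_all add: zk pA_def pB_def)
    have "\<alpha> < Re ((z * wirtinger_z f z - cnj z * wirtinger_zbar f z) / f z)"
      using star z z0 by (simp add: starlike_of_order_def Let_def)
    \<comment> \<open>The conjugation does not affect the real part; without it the expression is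
      the holomorphic function \<open>p\<close>.\<close>
    also have "(z * wirtinger_z f z - cnj z * wirtinger_zbar f z) / f z = pA s - cnj (pB s)"
      unfolding 1 2 using fz by (simp add: right_diff_distrib[symmetric])
    finally show "\<alpha> < Re (pA s - pB s)" by simp
    have "cnj (wirtinger_zbar f z) / cnj (f z) = \<omega> z * (wirtinger_z f z / f z)"
      using \<omega> z fz by (simp add: second_dilatation_def)
    then have "z * cnj (wirtinger_zbar f z) / cnj (f z) = \<omega> z * (z * wirtinger_z f z / f z)"
      by (metis mult.assoc mult.left_commute times_divide_eq_right)
    moreover have "z * cnj (wirtinger_zbar f z) = cnj (f z) * pB s"
      using arg_cong[OF 2, of cnj] by simp
    ultimately have "pB s = \<omega> z * pA s"
      using fz by (simp add: 1)
    then show "\<exists>z\<in>unit_disc. pB s = \<omega> z * pA s" using z by blast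
  qed
  have re: "\<alpha> < Re (pA s - pB s)" if s: "s \<in> unit_disc" for s
    using *(1)[OF s] \<alpha> by (cases "s = 0") (auto simp: pA_def pB_def)
  \<comment> \<open>By the dilatation equation a zero of \<open>pA\<close> off the origin is a zero
    of \<open>pB\<close>, so \<open>pA - pB\<close> would vanish although its real part exceeds
    \<open>\<alpha> \<ge> 0\<close>.\<close>
  have nz: "pA s \<noteq> 0" if s: "s \<in> unit_disc" for s
  proof
    assume "pA s = 0"
    moreover from this have "s \<noteq> 0" by (auto simp: pA_def)
    ultimately have "pA s - pB s = 0" using *(2)[OF s] by auto
    then show False using re[OF s] \<alpha> by simp
  qed
  have "starlike_logarithms k \<alpha> A B (\<lambda>s. pB s / pA s)"
  proof
    have "deriv A holomorphic_on unit_disc" "deriv B holomorphic_on unit_disc"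
      by (auto intro!: holomorphic_deriv A B)
    then have "pA holomorphic_on unit_disc" "pB holomorphic_on unit_disc"
      unfolding pA_def pB_def by (auto intro!: holomorphic_intros)
    then show "(\<lambda>s. pB s / pA s) holomorphic_on unit_disc"
      using nz by (auto intro!: holomorphic_intros)
    show "norm (pB s / pA s) < 1" if s: "s \<in> unit_disc" for s
    proof (cases "s = 0")
      case False
      then obtain z where "z \<in> unit_disc" "pB s = \<omega> z * pA s" using *(2)[OF s] by blast
      then show ?thesis
        using nz[OF s] \<omega> by (simp add: second_dilatation_def)
    qed (simp add: pB_def)
    show "of_nat k * s * deriv B s = pB s / pA s * (1 + of_nat k * s * deriv A s)" if "s \<in> unit_disc" for s
      using nz[OF that] by (simp add: pA_def pB_def)
    show "\<alpha> < Re (1 + of_nat k * s * deriv A s - of_nat k * s * deriv B s)" if "s \<in> unit_disc" for s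
      using re[OF that] by (simp add: pA_def pB_def)
  qed (use assms in \<open>simp_all add: pB_def\<close>)
  then show ?thesis by (simp add: pA_def pB_def)
qed

section \<open>Distance from the origin to the boundary of the image\<close>

text \<open>If the image were the whole plane, \<open>\<bar>f\<bar>\<close> would exceed 2 on some circle, and the reciprocal of the
  holomorphic factor of the same modulus would violate the maximum principle there.\<close>

lemma frontier_image_nonempty:
  fixes f :: "complex \<Rightarrow> complex"
  assumes inj: "inj_on f unit_disc" and cont: "continuous_on unit_disc f"
    and E: "E holomorphic_on unit_disc" "E 0 = 0"
    and norm_f: "\<And>z. z \<in> unit_disc \<Longrightarrow> norm (f z) = norm z * exp (Re (E z))"
  shows "frontier (f ` unit_disc) \<noteq> {}"
proof
  assume "frontier (f ` unit_disc) = {}"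
  then have UN: "f ` unit_disc = UNIV"
    using frontier_eq_empty[of "f ` unit_disc"] by auto
  obtain g where g: "homeomorphism unit_disc (f ` unit_disc) f g"
    using invariance_of_domain_homeomorphism[OF open_ball cont _ inj] by auto
  have "compact (g ` cball 0 2)"
    using g unfolding homeomorphism_def UN by (intro compact_continuous_image) (auto intro: continuous_on_subset)
  moreover have sub: "g ` cball 0 2 \<subseteq> unit_disc"
    using g unfolding homeomorphism_def UN by blast
  ultimately obtain \<rho> where \<rho>: "\<rho> < 1" "g ` cball 0 2 \<subseteq> cball 0 \<rho>"
  proof -
    assume a: "\<And>\<rho>. \<rho> < 1 \<Longrightarrow> g ` cball 0 2 \<subseteq> cball 0 \<rho> \<Longrightarrow> thesis"
    have "g ` cball 0 2 \<noteq> {}" by simp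
    from continuous_attains_sup[OF \<open>compact (g ` cball 0 2)\<close> this, of norm]
    obtain x where "x \<in> g ` cball 0 2" "\<forall>y\<in>g ` cball 0 2. norm y \<le> norm x"
      by (auto intro: continuous_intros)
    then show thesis using sub by (intro a[of "norm x"]) auto
  qed
  define r where "r = (max \<rho> 0 + 1) / 2"
  have r: "\<rho> < r" "0 < r" "r < 1" using \<rho> by (auto simp: r_def max_def)
  have big: "2 < norm (f z)" if "norm z = r" for z
  proof (rule ccontr)
    assume "\<not> 2 < norm (f z)"
    then have "f z \<in> cball 0 2" by simp
    then have "g (f z) \<in> cball 0 \<rho>" using \<rho> by blast
    moreover have "g (f z) = z"
      using g that r unfolding homeomorphism_def by auto
    ultimately show False using that r by simp
  qed
  have "norm (exp (- E 0)) \<le> 1/2"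
  proof (rule maximum_modulus_frontier[of "\<lambda>z. exp (- E z)" "cball 0 r"])
    show "(\<lambda>z. exp (- E z)) holomorphic_on interior (cball 0 r)"
      using r by (intro holomorphic_intros holomorphic_on_subset[OF E(1)]) auto
    show "continuous_on (closure (cball 0 r)) (\<lambda>z. exp (- E z))"
      using r by (intro continuous_intros holomorphic_on_imp_continuous_on holomorphic_on_subset[OF E(1)]) auto
    fix z :: complex assume "z \<in> frontier (cball 0 r)"
    then have z: "norm z = r" using r by simp
    have "2 < exp (Re (E z))"
    proof -
      have "2 < r * exp (Re (E z))" using big[OF z] norm_f[of z] z r by simp
      also have "\<dots> \<le> 1 * exp (Re (E z))" using r by (intro mult_right_mono) auto
      finally show ?thesis by simp
    qed
    then show "norm (exp (- E z)) \<le> 1/2"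
      unfolding norm_exp_eq_Re by (simp add: exp_minus field_simps)
  qed (use r in auto)
  then show False using E by simp
qed

lemma frontier_image_norm_ge:
  fixes f :: "complex \<Rightarrow> complex"
  assumes inj: "inj_on f unit_disc" and cont: "continuous_on unit_disc f" and m: "0 < m"
    and ge: "\<And>z. z \<in> unit_disc \<Longrightarrow> norm z * m \<le> norm (f z)"
    and w: "w \<in> frontier (f ` unit_disc)"
  shows "m \<le> norm w"
proof (rule ccontr)
  assume "\<not> m \<le> norm w"
  then obtain \<rho> where \<rho>: "norm w / m < \<rho>" "\<rho> < 1"
    using dense[of "norm w / m" 1] m by auto
  have "open (f ` unit_disc)"
    using invariance_of_domain[OF cont open_ball inj] .
  then have wn: "w \<notin> f ` unit_disc" "w \<in> closure (f ` unit_disc)"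
    using w by (auto simp: frontier_def interior_open)
  have "f ` unit_disc \<subseteq> f ` cball 0 \<rho> \<union> {v. \<rho> * m \<le> norm v}"
  proof
    fix v assume "v \<in> f ` unit_disc"
    then obtain z where z: "v = f z" "z \<in> unit_disc" by blast
    show "v \<in> f ` cball 0 \<rho> \<union> {v. \<rho> * m \<le> norm v}"
    proof (cases "norm z \<le> \<rho>")
      case False
      then have "\<rho> * m \<le> norm z * m" using m by simp
      then show ?thesis using ge[OF z(2)] z by simp
    qed (use z in auto)
  qed
  moreover have "closed (f ` cball 0 \<rho> \<union> {v. \<rho> * m \<le> norm v})"
  proof (rule closed_Un)
    have "continuous_on (cball 0 \<rho>) f"
      using cont cball_subset_unit_disc[OF \<rho>(2)] by (rule continuous_on_subset)
    then show "closed (f ` cball 0 \<rho>)"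
      by (intro compact_imp_closed compact_continuous_image) auto
    show "closed {v::complex. \<rho> * m \<le> norm v}"
      by (intro closed_Collect_le continuous_intros)
  qed
  ultimately have "w \<in> f ` cball 0 \<rho> \<union> {v. \<rho> * m \<le> norm v}"
    using wn closure_minimal by blast
  moreover have "w \<notin> f ` cball 0 \<rho>"
    using wn cball_subset_unit_disc[OF \<rho>(2)] by blast
  ultimately have "\<rho> * m \<le> norm w" by simp
  then show False using \<rho> m by (simp add: divide_less_eq)
qed

section \<open>The radius function\<close>

text \<open>The sharp lower bound for \<open>norm (f z) / norm z\<close>; the extremal mapping takes
  this modulus at the points with \<open>z ^ k = -1\<close>.\<close>

definition covering_radius :: "nat \<Rightarrow> real \<Rightarrow> real" where
  "covering_radius k \<alpha> = exp ((- 2 * (1 - \<alpha>) - 2 * \<alpha> * ln 2) / k)"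

text \<open>The closed form of the power series whose coefficients are the bounds
  \<open>(4 * (1 - \<alpha>) + 2 * \<alpha> / n) / k\<close> of \<open>coeff_bound\<close>.\<close>

definition growth_exponent :: "nat \<Rightarrow> real \<Rightarrow> real \<Rightarrow> real" where
  "growth_exponent k \<alpha> s = (4 * (1 - \<alpha>) * (s / (1 - s)) - 2 * \<alpha> * ln (1 - s)) / k"

text \<open>The quotient inside the last factor accounts for
  \<open>norm (z * wirtinger_z f z)\<close>, the summand 1 for the exponential of the coefficient
  series.\<close>

definition bohr_majorant :: "nat \<Rightarrow> real \<Rightarrow> real \<Rightarrow> real" where
  "bohr_majorant k \<alpha> r =
     r * exp (growth_exponent k \<alpha> (r ^ k)) * ((1 + (1 - 2 * \<alpha>) * r ^ k) / (1 - r ^ k)\<^sup>2 + 1)"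

lemma covering_radius_pos: "0 < covering_radius k \<alpha>"
  by (simp add: covering_radius_def)

text \<open>Since \<open>(1 + s) / (1 - s) = 1 + 2 * s / (1 - s)\<close>, the constant part of the
  exponent and the power of 2 cancel against the covering radius. The polynomial is the numerator of
  the distortion bound plus \<open>(1 - s)^2\<close>, and the exponent
  \<open>2 * (\<alpha> + k) / k = 2 * \<alpha> / k + 2\<close> supplies the denominator
  \<open>(1 - s)^2\<close>.\<close>

lemma radius_function_conv_majorant:
  assumes k: "1 \<le> k" and r: "0 \<le> r" "r < 1"
  shows "covering_radius k \<alpha> * radius_function k \<alpha> r = bohr_majorant k \<alpha> r"
proof -
  define s where "s = r ^ k"
  have s: "s < 1" using r k by (auto simp: s_def power_less_one_iff)
  have k0: "real k \<noteq> 0" using k by simp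
  have 1: "2 powr (2 * \<alpha> / real k) = exp (2 * \<alpha> * ln 2 / k)"
    by (simp add: powr_def)
  have 2: "(1 - s) powr (2 * (\<alpha> + real k) / real k) = exp (2 * \<alpha> * ln (1 - s) / k) * (1 - s)\<^sup>2"
  proof -
    have "2 * (\<alpha> + real k) / real k = 2 * \<alpha> / k + 2"
      using k0 by (simp add: field_simps)
    then show ?thesis
      using s by (simp add: powr_add powr_def[of _ "2 * \<alpha> / k"])
  qed
  have 3: "exp ((- 2 * (1 - \<alpha>) - 2 * \<alpha> * ln 2) / k) * exp (2 * \<alpha> * ln 2 / k)
       * exp (2 * (1 - \<alpha>) * (1 + s) / (k * (1 - s))) / exp (2 * \<alpha> * ln (1 - s) / k)
     = exp (growth_exponent k \<alpha> s)"
    unfolding growth_exponent_def exp_add[symmetric] exp_diff[symmetric]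
    using s k0 by (intro arg_cong[where f = exp]) (simp add: field_simps)
  have 4: "2 - (1 + 2 * \<alpha>) * s + s\<^sup>2 = (1 + (1 - 2 * \<alpha>) * s) + (1 - s)\<^sup>2"
    by (simp add: power2_eq_square algebra_simps)
  have 5: "r ^ (2 * k) = s\<^sup>2"
    by (simp add: s_def power_mult[symmetric] mult.commute)
  have 6: "(1 + (1 - 2 * \<alpha>) * s) / (1 - s)\<^sup>2 + 1 = ((1 + (1 - 2 * \<alpha>) * s) + (1 - s)\<^sup>2) / (1 - s)\<^sup>2"
    using s by (simp add: add_divide_distrib)
  have 7: "c * (p * r * n / (a * d) * x) = r * (c * p * x / a) * (n / d)" for c p n a d x :: real
    by (simp add: divide_inverse mult_ac)
  show ?thesis
    unfolding radius_function_def bohr_majorant_def covering_radius_def s_def[symmetric] 1 2 4 5 6 7 3 ..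
qed

text \<open>For \<open>\<alpha> > 1/2\<close> the numerator decreases in \<open>s\<close>. The
  decomposition has only nonnegative increasing terms, which makes positivity and monotonicity
  evident.\<close>

lemma majorant_factor_eq: "s < 1 \<Longrightarrow> (1 + (1 - 2 * \<alpha>) * s) / (1 - s)\<^sup>2 = 1 / (1 - s) + 2 * (1 - \<alpha>) * (s / (1 - s) * (1 / (1 - s)))"
  for s :: real
proof -
  assume "s < 1"
  moreover have "1 + (1 - 2 * \<alpha>) * s = (1 - s) + 2 * (1 - \<alpha>) * s"
    by (simp add: algebra_simps)
  ultimately show ?thesis
    by (simp only: add_divide_distrib) (simp add: power2_eq_square)
qed

lemma growth_exponent_mono:
  assumes "0 \<le> \<alpha>" "\<alpha> < 1" "0 \<le> s" "s \<le> t" "t < 1"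
  shows "growth_exponent k \<alpha> s \<le> growth_exponent k \<alpha> t"
  unfolding growth_exponent_def using assms
  by (intro divide_right_mono diff_mono mult_left_mono frac_le) auto

lemma bohr_majorant_strict_mono:
  assumes k: "1 \<le> k" and \<alpha>: "0 \<le> \<alpha>" "\<alpha> < 1" and r: "0 \<le> r" "r < t" "t < 1"
  shows "bohr_majorant k \<alpha> r < bohr_majorant k \<alpha> t"
proof -
  have s: "0 \<le> r ^ k" "r ^ k \<le> t ^ k" "t ^ k < 1"
    using r k by (auto intro: power_mono simp: power_less_one_iff)
  have b: "(1 + (1 - 2 * \<alpha>) * r ^ k) / (1 - r ^ k)\<^sup>2 \<le> (1 + (1 - 2 * \<alpha>) * t ^ k) / (1 - t ^ k)\<^sup>2"
    unfolding majorant_factor_eq[OF s(3)] majorant_factor_eq[OF order.strict_trans1[OF s(2,3)]]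
    using s \<alpha> by (intro add_mono mult_left_mono mult_mono frac_le) auto
  have p: "0 \<le> (1 + (1 - 2 * \<alpha>) * r ^ k) / (1 - r ^ k)\<^sup>2"
    unfolding majorant_factor_eq[OF order.strict_trans1[OF s(2,3)]] using s \<alpha> by auto
  have e: "exp (growth_exponent k \<alpha> (r ^ k)) \<le> exp (growth_exponent k \<alpha> (t ^ k))"
    using s \<alpha> by (simp add: growth_exponent_mono)
  have "bohr_majorant k \<alpha> r \<le> r * exp (growth_exponent k \<alpha> (t ^ k)) * ((1 + (1 - 2 * \<alpha>) * t ^ k) / (1 - t ^ k)\<^sup>2 + 1)"
    unfolding bohr_majorant_def using b p e r by (intro mult_mono mult_nonneg_nonneg) auto
  \<comment> \<open>The other factors are compared weakly; strictness comes from the leading factor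
    \<open>r\<close>.\<close>
  also have "\<dots> < bohr_majorant k \<alpha> t"
    unfolding bohr_majorant_def using r b p by (intro mult_strict_right_mono) auto
  finally show ?thesis .
qed

lemma bohr_majorant_root:
  assumes k: "1 \<le> k" and \<alpha>: "0 \<le> \<alpha>" "\<alpha> < 1"
  obtains r where "0 < r" "r < 1" "bohr_majorant k \<alpha> r = covering_radius k \<alpha>"
proof -
  have lt: "r ^ k < 1" if "0 \<le> r" "r \<le> 1/2" for r :: real
    using that k by (simp add: power_less_one_iff)
  have "covering_radius k \<alpha> \<le> 1"
  proof -
    have "- 2 * (1 - \<alpha>) \<le> 0" "0 \<le> 2 * \<alpha> * ln 2" using \<alpha> by simp_all
    then have "- 2 * (1 - \<alpha>) - 2 * \<alpha> * ln 2 \<le> 0"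
      unfolding diff_le_0_iff_le by (rule order_trans)
    then have "(- 2 * (1 - \<alpha>) - 2 * \<alpha> * ln 2) / k \<le> 0" by (intro divide_nonpos_nonneg) auto
    then show ?thesis by (simp only: covering_radius_def exp_le_one_iff)
  qed
  \<comment> \<open>At \<open>r = 1/2\<close> the exponential is at least 1 and the last factor at
    least 2, so the intermediate value theorem can be applied on \<open>{0..1/2}\<close>, away from
    the singularity at 1.\<close>
  also have "\<dots> \<le> bohr_majorant k \<alpha> (1/2)"
  proof -
    define s where "s = (1/2 :: real) ^ k"
    have s: "0 \<le> s" "s < 1" using lt[of "1/2"] by (auto simp: s_def)
    have "growth_exponent k \<alpha> 0 \<le> growth_exponent k \<alpha> s"
      using \<alpha> s by (intro growth_exponent_mono) auto
    then have "1 \<le> exp (growth_exponent k \<alpha> s)" by (simp add: growth_exponent_def)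
    moreover have "1 + 0 + 1 \<le> (1 + (1 - 2 * \<alpha>) * s) / (1 - s)\<^sup>2 + 1"
      unfolding majorant_factor_eq[OF s(2)] using s \<alpha>
      by (intro add_mono mult_nonneg_nonneg divide_nonneg_pos) auto
    ultimately have "1/2 * 1 * 2 \<le> 1/2 * exp (growth_exponent k \<alpha> s) * ((1 + (1 - 2 * \<alpha>) * s) / (1 - s)\<^sup>2 + 1)"
      by (intro mult_mono) auto
    then show ?thesis by (simp add: bohr_majorant_def s_def)
  qed
  finally have up: "covering_radius k \<alpha> \<le> bohr_majorant k \<alpha> (1/2)" .
  have ne: "1 - r ^ k \<noteq> 0" if "r \<in> {0..1/2}" for r :: real
    using lt[of r] that by auto
  have "continuous_on {0..1/2} (bohr_majorant k \<alpha>)"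
    unfolding bohr_majorant_def growth_exponent_def
    by (intro continuous_intros ballI) (use ne k in auto)
  moreover have "bohr_majorant k \<alpha> 0 \<le> covering_radius k \<alpha>"
    using covering_radius_pos[of k \<alpha>] by (simp add: bohr_majorant_def)
  ultimately obtain r where r: "0 \<le> r" "r \<le> 1/2" "bohr_majorant k \<alpha> r = covering_radius k \<alpha>"
    using IVT'[of "bohr_majorant k \<alpha>" 0 "covering_radius k \<alpha>" "1/2"] up by auto
  moreover have "r \<noteq> 0"
    using r covering_radius_pos[of k \<alpha>] by (auto simp: bohr_majorant_def)
  ultimately show ?thesis using that[of r] by auto
qed

lemma growth_exponent_sums:
  assumes s: "0 \<le> s" "s < 1"
  shows "(\<lambda>n. (4 * (1 - \<alpha>) + 2 * \<alpha> / Suc n) / k * s ^ Suc n) sums growth_exponent k \<alpha> s"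
proof -
  have "(\<lambda>n. - ((- (- s)) ^ n) / real n) sums ln (1 + (- s))"
    using s by (intro ln_series') auto
  then have 1: "(\<lambda>n. - (s ^ Suc n) / real (Suc n)) sums ln (1 - s)"
    by (subst sums_Suc_iff) simp
  have 2: "(\<lambda>n. s ^ Suc n) sums (s / (1 - s))"
    using sums_mult[OF geometric_sums[of s], of s] s by simp
  have "(\<lambda>n. (4 * (1 - \<alpha>) * s ^ Suc n - 2 * \<alpha> * (- (s ^ Suc n) / real (Suc n))) / k) sums growth_exponent k \<alpha> s"
    unfolding growth_exponent_def by (intro sums_divide sums_diff sums_mult 1 2)
  then show ?thesis
    by (rule sums_cong[THEN iffD1, rotated]) (simp add: field_simps)
qed

section \<open>Series majorants for the two logarithms\<close>

context starlike_logarithms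
begin

lemma coeff_sum_le:
  assumes FA: "A has_fps_expansion FA" and FB: "B has_fps_expansion FB" and c: "norm c = 1"
    and s: "0 \<le> s" "s < 1"
  shows "(\<Sum>n. norm (fps_nth FA (Suc n) + c * fps_nth FB (Suc n)) * s ^ Suc n) \<le> growth_exponent k \<alpha> s"
proof -
  have le: "norm (fps_nth FA (Suc n) + c * fps_nth FB (Suc n)) * s ^ Suc n
       \<le> (4 * (1 - \<alpha>) + 2 * \<alpha> / Suc n) / k * s ^ Suc n" for n
    using coeff_bound[OF FA FB c, of "Suc n"] s by (intro mult_right_mono) auto
  note sums = growth_exponent_sums[OF s, of \<alpha> k]
  have "summable (\<lambda>n. norm (fps_nth FA (Suc n) + c * fps_nth FB (Suc n)) * s ^ Suc n)"
    by (rule summable_comparison_test[OF _ sums_summable[OF sums]])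
       (use le s in \<open>auto simp: abs_mult intro!: exI[of _ 0]\<close>)
  then have "(\<Sum>n. norm (fps_nth FA (Suc n) + c * fps_nth FB (Suc n)) * s ^ Suc n)
      \<le> (\<Sum>n. (4 * (1 - \<alpha>) + 2 * \<alpha> / Suc n) / k * s ^ Suc n)"
    using le sums_summable[OF sums] by (intro suminf_le) auto
  then show ?thesis using sums by (simp only: sums_iff)
qed

lemma Re_sum_le:
  assumes s: "norm s < 1"
  shows "Re (A s + B s) \<le> growth_exponent k \<alpha> (norm s)"
proof -
  define FA where "FA = fps_expansion A 0"
  define FB where "FB = fps_expansion B 0"
  have FA: "A has_fps_expansion FA" and FB: "B has_fps_expansion FB"
    using A B unfolding FA_def FB_def by (auto intro!: has_fps_expansion_fps_expansion[of unit_disc])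
  have "(\<lambda>n. fps_nth (FA + FB) n * s ^ n) sums (A s + B s)"
  proof (rule has_fps_expansion_imp_sums_complex[where r = 1 and f = "\<lambda>s. A s + B s"])
    show "(\<lambda>s. A s + B s) holomorphic_on eball 0 1"
      using A B by (auto simp: one_ereal_def intro!: holomorphic_intros)
  qed (use s FA FB in \<open>auto simp: one_ereal_def intro!: fps_expansion_intros\<close>)
  moreover have "fps_nth (FA + FB) 0 * s ^ 0 = 0"
    using A B by (simp add: fps_nth_fps_expansion[OF FA] fps_nth_fps_expansion[OF FB])
  ultimately have sums: "(\<lambda>n. fps_nth (FA + FB) (Suc n) * s ^ Suc n) sums (A s + B s)"
    by (subst sums_Suc_iff) simp
  note E = growth_exponent_sums[OF norm_ge_zero s, of \<alpha> k]
  have "norm (\<Sum>n. fps_nth (FA + FB) (Suc n) * s ^ Suc n) \<le> (\<Sum>n. (4 * (1 - \<alpha>) + 2 * \<alpha> / Suc n) / k * norm s ^ Suc n)"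
  proof (rule norm_suminf_le[OF _ sums_summable[OF E]])
    fix n
    show "norm (fps_nth (FA + FB) (Suc n) * s ^ Suc n) \<le> (4 * (1 - \<alpha>) + 2 * \<alpha> / Suc n) / k * norm s ^ Suc n"
      unfolding norm_mult norm_power
      using coeff_bound[OF FA FB, of 1 "Suc n"] by (intro mult_right_mono) auto
  qed
  then have "norm (A s + B s) \<le> growth_exponent k \<alpha> (norm s)"
    using sums E by (simp only: sums_iff)
  then show ?thesis
    using complex_Re_le_cmod order_trans by blast
qed

end

section \<open>Univalence\<close>

context starlike_logarithms
begin

text \<open>In the logarithmic coordinate \<open>z = exp \<zeta>\<close>, with
  \<open>\<zeta>\<close> in the left half-plane, this is \<open>z ^ k\<close>.\<close>

definition lift :: "complex \<Rightarrow> complex" where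
  "lift \<zeta> = exp (of_nat k * \<zeta>)"

lemma lift_in_disc: "Re \<zeta> < 0 \<Longrightarrow> lift \<zeta> \<in> unit_disc"
  using k by (simp add: lift_def mult_pos_neg)

text \<open>A logarithm of \<open>f\<close> is \<open>\<zeta> + A + cnj B\<close>, which is not
  holomorphic. Its imaginary part is that of \<open>\<psi>\<close> and its real part is that of
  \<open>\<sigma>\<close>; both of these are holomorphic, with derivatives \<open>p\<close> and
  \<open>p * Q\<close>.\<close>

definition \<psi> :: "complex \<Rightarrow> complex" where
  "\<psi> \<zeta> = \<zeta> + A (lift \<zeta>) - B (lift \<zeta>)"

definition \<sigma> :: "complex \<Rightarrow> complex" where
  "\<sigma> \<zeta> = \<zeta> + A (lift \<zeta>) + B (lift \<zeta>)"

lemma lift_DERIV: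
  assumes "F holomorphic_on unit_disc" "Re \<zeta> < 0"
  shows "((\<lambda>\<zeta>. F (lift \<zeta>)) has_field_derivative of_nat k * lift \<zeta> * deriv F (lift \<zeta>)) (at \<zeta>)"
proof -
  have "(lift has_field_derivative of_nat k * lift \<zeta>) (at \<zeta>)"
    unfolding lift_def by (auto intro!: derivative_eq_intros)
  from DERIV_chain2[OF holomorphic_derivI[OF assms(1) open_ball lift_in_disc[OF assms(2)]] this]
  show ?thesis by (simp add: mult_ac)
qed

lemma psi_DERIV:
  assumes "Re \<zeta> < 0"
  shows "(\<psi> has_field_derivative p (lift \<zeta>)) (at \<zeta>)"
  unfolding \<psi>_def p_def
  by (auto intro!: derivative_eq_intros lift_DERIV A B assms)

lemma sigma_DERIV:
  assumes "Re \<zeta> < 0"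
  shows "(\<sigma> has_field_derivative p (lift \<zeta>) * Q (lift \<zeta>)) (at \<zeta>)"
proof -
  have "(\<sigma> has_field_derivative 1 + of_nat k * lift \<zeta> * deriv A (lift \<zeta>) + of_nat k * lift \<zeta> * deriv B (lift \<zeta>)) (at \<zeta>)"
    unfolding \<sigma>_def by (auto intro!: derivative_eq_intros lift_DERIV A B assms)
  then show ?thesis
    using combination_eq[OF lift_in_disc[OF assms], of 1] by simp
qed

lemma Re_p_pos: "s \<in> unit_disc \<Longrightarrow> 0 < Re (p s)"
  using starlike[of s] \<alpha> by (simp add: p_def)

lemma Re_Q_pos: "s \<in> unit_disc \<Longrightarrow> 0 < Re (Q s)"
proof -
  assume s: "s \<in> unit_disc"
  have "Q s = 1 + 2 * (W s / (1 - W s))"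
    using one_minus_W[OF s] by (simp add: Q_def field_simps)
  then show ?thesis
    using Re_div_one_minus[OF W1[OF s]] by (simp flip: times_divide_eq_right)
qed

text \<open>Moving \<open>\<zeta>\<close> vertically is moving \<open>z\<close> along a circle, so
  positivity of this derivative is starlikeness: \<open>arg f\<close> increases along
  circles.\<close>

lemma Im_psi_DERIV:
  assumes "x < 0"
  shows "((\<lambda>y. Im (\<psi> (Complex x y))) has_real_derivative Re (p (lift (Complex x y)))) (at y)"
proof -
  have 1: "((\<lambda>y. Complex x y) has_vector_derivative \<i>) (at y)"
    unfolding Complex_eq by (auto intro!: derivative_eq_intros)
  have "((\<psi> \<circ> (\<lambda>y. Complex x y)) has_vector_derivative (\<i> * p (lift (Complex x y)))) (at y)"
    by (rule field_vector_diff_chain_at[OF 1]) (use assms in \<open>auto intro: psi_DERIV\<close>)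
  from bounded_linear.has_vector_derivative[OF bounded_linear_Im this]
  show ?thesis by (simp add: has_real_derivative_iff_has_vector_derivative o_def)
qed

lemma Im_psi_strict_mono:
  assumes "x < 0" "y < y'"
  shows "Im (\<psi> (Complex x y)) < Im (\<psi> (Complex x y'))"
proof (rule DERIV_pos_imp_increasing[OF assms(2)])
  fix t
  show "\<exists>d. ((\<lambda>y. Im (\<psi> (Complex x y))) has_real_derivative d) (at t) \<and> 0 < d"
    using Im_psi_DERIV[OF assms(1), of t] Re_p_pos lift_in_disc[of "Complex x t"] assms(1) by auto
qed

lemma Im_psi_less_iff: "x < 0 \<Longrightarrow> Im (\<psi> (Complex x y)) < Im (\<psi> (Complex x y')) \<longleftrightarrow> y < y'"
  using Im_psi_strict_mono[of x y y'] Im_psi_strict_mono[of x y' y] by (metis linorder_neqE_linordered_idom order_less_asym)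

text \<open>On a vertical line \<open>lift\<close> stays on one circle inside the disc, where
  \<open>A - B\<close> is bounded by some \<open>M\<close>. Thus \<open>Im \<psi>\<close> differs
  from \<open>y\<close> by at most \<open>M\<close>, and the intermediate value theorem applies on
  \<open>{c - M..c + M}\<close>.\<close>

lemma Im_psi_surj:
  assumes x: "x < 0"
  shows "\<exists>y. Im (\<psi> (Complex x y)) = c"
proof -
  define r where "r = exp (k * x)"
  have r: "r < 1" using x k by (simp add: r_def mult_pos_neg)
  have "continuous_on (cball 0 r) (\<lambda>s. A s - B s)"
    using A B cball_subset_unit_disc[OF r]
    by (intro continuous_intros holomorphic_on_imp_continuous_on) (auto intro: holomorphic_on_subset)
  then have "bounded ((\<lambda>s. A s - B s) ` cball 0 r)"
    by (intro compact_imp_bounded compact_continuous_image) auto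
  then obtain M where M: "\<And>s. s \<in> cball 0 r \<Longrightarrow> norm (A s - B s) \<le> M"
    unfolding bounded_iff by blast
  have bd: "\<bar>Im (\<psi> (Complex x y)) - y\<bar> \<le> M" for y
  proof -
    have "norm (lift (Complex x y)) = r" by (simp add: lift_def r_def)
    then have "norm (A (lift (Complex x y)) - B (lift (Complex x y))) \<le> M" by (intro M) simp
    then show ?thesis
      using abs_Im_le_cmod[of "A (lift (Complex x y)) - B (lift (Complex x y))"] by (simp add: \<psi>_def)
  qed
  have M0: "0 \<le> M" using bd[of 0] by linarith
  have "\<exists>y. c - M \<le> y \<and> y \<le> c + M \<and> Im (\<psi> (Complex x y)) = c"
  proof (rule IVT')
    show "Im (\<psi> (Complex x (c - M))) \<le> c" using bd[of "c - M"] by linarith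
    show "c \<le> Im (\<psi> (Complex x (c + M)))" using bd[of "c + M"] by linarith
    show "continuous_on {c - M..c + M} (\<lambda>y. Im (\<psi> (Complex x y)))"
      by (rule continuous_at_imp_continuous_on) (use Im_psi_DERIV[OF x] in \<open>auto intro: DERIV_isCont\<close>)
  qed (use M0 in simp)
  then show ?thesis by blast
qed

text \<open>The level sets of \<open>Im \<psi>\<close>, on which \<open>arg f\<close> is constant, are graphs over the negative half-line, and
  \<open>Re \<sigma> = ln \<bar>f\<bar>\<close> increases along each of them.\<close>

definition level :: "real \<Rightarrow> real \<Rightarrow> real" where
  "level c x = (SOME y. Im (\<psi> (Complex x y)) = c)"

lemma Im_psi_level: "x < 0 \<Longrightarrow> Im (\<psi> (Complex x (level c x))) = c"
  unfolding level_def by (rule someI_ex) (rule Im_psi_surj)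

text \<open>By strict monotonicity in \<open>y\<close>, \<open>Im \<psi>\<close> lies below
  \<open>c\<close> at height \<open>y - e\<close> and above it at \<open>y + e\<close>. Both
  inequalities persist for nearby abscissae and trap the level curve in between.\<close>

lemma isCont_level:
  assumes x: "x < 0"
  shows "isCont (level c) x"
  unfolding isCont_def tendsto_iff
proof (intro allI impI)
  fix e :: real assume e: "0 < e"
  define y where "y = level c x"
  have c1: "isCont (\<lambda>x. Im (\<psi> (Complex x t))) x" for t
  proof -
    have "isCont \<psi> (Complex x t)"
      using psi_DERIV[of "Complex x t"] x by (auto intro: DERIV_isCont)
    moreover have "isCont (\<lambda>x. Complex x t) x"
      unfolding Complex_eq by (intro continuous_intros)
    ultimately have "isCont (\<lambda>x. \<psi> (Complex x t)) x"
      by (rule isCont_o2[rotated])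
    then show ?thesis by (rule continuous_Im)
  qed
  have "Im (\<psi> (Complex x (y - e))) < c" "c < Im (\<psi> (Complex x (y + e)))"
    using Im_psi_strict_mono[OF x, of "y - e" y] Im_psi_strict_mono[OF x, of y "y + e"] e
      Im_psi_level[OF x, of c] by (simp_all add: y_def)
  then have "\<forall>\<^sub>F x' in at x. Im (\<psi> (Complex x' (y - e))) < c" "\<forall>\<^sub>F x' in at x. c < Im (\<psi> (Complex x' (y + e)))"
    using c1[of "y - e"] c1[of "y + e"] by (auto simp: isCont_def intro: order_tendstoD)
  moreover have "\<forall>\<^sub>F x' in at x. x' < 0"
    using x order_tendstoD(2)[OF tendsto_ident_at, of x 0] by simp
  ultimately show "\<forall>\<^sub>F x' in at x. dist (level c x') (level c x) < e"
  proof eventually_elim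
    case (elim x')
    then have "y - e < level c x'" "level c x' < y + e"
      using Im_psi_level[of x' c] Im_psi_less_iff[of x' _ "level c x'"] Im_psi_less_iff[of x' "level c x'"] by auto
    then show ?case by (simp add: y_def dist_real_def abs_less_iff)
  qed
qed

text \<open>Implicit differentiation through Caratheodory's form of the derivative: the increment of
  \<open>\<psi>\<close> is \<open>g\<close> times the increment of the point. Its imaginary part
  vanishes on the level curve, so the difference quotient equals \<open>- Im g / Re g\<close>
  exactly, and continuity of \<open>g\<close> gives the limit.\<close>

lemma level_DERIV:
  assumes x: "x < 0" and d_def: "d = p (lift (Complex x (level c x)))"
  shows "(level c has_real_derivative - Im d / Re d) (at x)"
proof -
  define \<Gamma> where "\<Gamma> = (\<lambda>x. Complex x (level c x))"
  have d0: "0 < Re d"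
    unfolding d_def using x by (intro Re_p_pos lift_in_disc) simp
  have "(\<psi> has_field_derivative d) (at (\<Gamma> x))"
    unfolding d_def \<Gamma>_def using x by (intro psi_DERIV) simp
  then obtain g where g: "\<And>z. \<psi> z - \<psi> (\<Gamma> x) = g z * (z - \<Gamma> x)" "isCont g (\<Gamma> x)" "g (\<Gamma> x) = d"
    unfolding CARAT_DERIV by blast
  have "isCont \<Gamma> x"
    unfolding \<Gamma>_def Complex_eq by (intro continuous_intros isCont_level x)
  then have "isCont (\<lambda>x. g (\<Gamma> x)) x"
    using g(2) by (rule isCont_o2)
  then have lim: "((\<lambda>x. g (\<Gamma> x)) \<longlongrightarrow> d) (at x)"
    using g(3) by (simp add: isCont_def)
  have "((\<lambda>x. - Im (g (\<Gamma> x)) / Re (g (\<Gamma> x))) \<longlongrightarrow> - Im d / Re d) (at x)"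
    using d0 by (intro tendsto_intros lim) simp
  moreover have "\<forall>\<^sub>F x' in at x. - Im (g (\<Gamma> x')) / Re (g (\<Gamma> x')) = (level c x' - level c x) / (x' - x)"
  proof -
    have "\<forall>\<^sub>F x' in at x. 0 < Re (g (\<Gamma> x'))"
      using tendsto_Re[OF lim] d0 by (rule order_tendstoD)
    moreover have "\<forall>\<^sub>F x' in at x. x' < 0"
      using x order_tendstoD(2)[OF tendsto_ident_at, of x 0] by simp
    moreover have "\<forall>\<^sub>F x' in at x. x' \<noteq> x"
      by (simp add: eventually_at_filter)
    ultimately show ?thesis
    proof eventually_elim
      case (elim x')
      have "Im (\<psi> (\<Gamma> x') - \<psi> (\<Gamma> x)) = 0"
        using Im_psi_level[of x' c] Im_psi_level[of x c] elim x by (simp add: \<Gamma>_def)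
      then have "Re (g (\<Gamma> x')) * (level c x' - level c x) + Im (g (\<Gamma> x')) * (x' - x) = 0"
        unfolding g(1) by (simp add: \<Gamma>_def)
      then have "Re (g (\<Gamma> x')) * (level c x' - level c x) = - Im (g (\<Gamma> x')) * (x' - x)"
        by simp
      then show ?case
        using elim by (simp add: divide_simps mult.commute)
    qed
  qed
  ultimately have "((\<lambda>x'. (level c x' - level c x) / (x' - x)) \<longlongrightarrow> - Im d / Re d) (at x)"
    by (rule Lim_transform_eventually)
  then show ?thesis by (simp add: has_field_derivative_iff)
qed

text \<open>The tangent \<open>1 - \<i> * Im d / Re d\<close> times \<open>\<psi>' = d\<close> is
  the positive number \<open>norm d ^ 2 / Re d\<close>. Since \<open>\<sigma>' = d * Q\<close>, the
  derivative is a positive multiple of \<open>Re Q\<close>, and this is positive because the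
  dilatation is below 1 in modulus.\<close>

lemma Re_sigma_level_strict_mono:
  assumes "x < x'" "x' < 0"
  shows "Re (\<sigma> (Complex x (level c x))) < Re (\<sigma> (Complex x' (level c x')))"
proof (rule DERIV_pos_imp_increasing[OF assms(1)])
  fix t assume "x \<le> t" "t \<le> x'"
  then have t: "t < 0" using assms by simp
  define s where "s = lift (Complex t (level c t))"
  have s: "s \<in> unit_disc" unfolding s_def using t by (intro lift_in_disc) simp
  define d where "d = p s"
  have d0: "0 < Re d" unfolding d_def using s by (rule Re_p_pos)
  have "(level c has_vector_derivative - Im d / Re d) (at t)"
    using level_DERIV[OF t, of d c] by (simp add: d_def s_def has_real_derivative_iff_has_vector_derivative)
  from bounded_linear.has_vector_derivative[OF bounded_linear_of_real this]
  have "((\<lambda>x. of_real (level c x) :: complex) has_vector_derivative of_real (- Im d / Re d)) (at t)" .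
  then have "((\<lambda>x. Complex x (level c x)) has_vector_derivative (1 + \<i> * of_real (- Im d / Re d))) (at t)"
    unfolding Complex_eq
    by (intro has_vector_derivative_add has_vector_derivative_mult_right)
       (auto intro!: derivative_eq_intros)
  then have "((\<sigma> \<circ> (\<lambda>x. Complex x (level c x))) has_vector_derivative
      (1 + \<i> * of_real (- Im d / Re d)) * (d * Q s)) (at t)"
    by (rule field_vector_diff_chain_at) (use t in \<open>auto intro: sigma_DERIV simp: d_def s_def\<close>)
  from bounded_linear.has_vector_derivative[OF bounded_linear_Re this]
  have "((\<lambda>x. Re (\<sigma> (Complex x (level c x)))) has_real_derivative
      Re ((1 + \<i> * of_real (- Im d / Re d)) * (d * Q s))) (at t)"
    by (simp add: has_real_derivative_iff_has_vector_derivative o_def)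
  moreover have "(1 + \<i> * of_real (- Im d / Re d)) * d = of_real ((norm d)\<^sup>2 / Re d)"
    unfolding cmod_power2 using d0 by (simp add: complex_eq_iff field_simps power2_eq_square)
  then have "(1 + \<i> * of_real (- Im d / Re d)) * (d * Q s) = of_real ((norm d)\<^sup>2 / Re d) * Q s"
    by (simp only: mult.assoc[symmetric])
  then have "Re ((1 + \<i> * of_real (- Im d / Re d)) * (d * Q s)) = (norm d)\<^sup>2 / Re d * Re (Q s)"
    by simp
  moreover have "0 < (norm d)\<^sup>2 / Re d * Re (Q s)"
    using d0 Re_Q_pos[OF s] by (intro mult_pos_pos divide_pos_pos) auto
  ultimately show "\<exists>y. ((\<lambda>x. Re (\<sigma> (Complex x (level c x)))) has_real_derivative y) (at t) \<and> 0 < y"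
    by auto
qed

lemma level_set_injective:
  assumes "Re \<zeta> < 0" "Re \<zeta>' < 0" "Im (\<psi> \<zeta>) = Im (\<psi> \<zeta>')" "Re (\<sigma> \<zeta>) = Re (\<sigma> \<zeta>')"
  shows "\<zeta> = \<zeta>'"
proof -
  define c where "c = Im (\<psi> \<zeta>)"
  have on: "\<xi> = Complex (Re \<xi>) (level c (Re \<xi>))" if "Re \<xi> < 0" "Im (\<psi> \<xi>) = c" for \<xi>
  proof -
    have "Im \<xi> = level c (Re \<xi>)"
      using Im_psi_strict_mono[OF that(1), of "Im \<xi>" "level c (Re \<xi>)"]
        Im_psi_strict_mono[OF that(1), of "level c (Re \<xi>)" "Im \<xi>"] Im_psi_level[OF that(1), of c] that(2)
      by (metis complex_surj less_irrefl linorder_neqE_linordered_idom)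
    then show ?thesis by (simp add: complex_eq_iff)
  qed
  have "\<zeta> = Complex (Re \<zeta>) (level c (Re \<zeta>))" "\<zeta>' = Complex (Re \<zeta>') (level c (Re \<zeta>'))"
    using on assms by (auto simp: c_def)
  moreover from this have "Re \<zeta> = Re \<zeta>'"
    using Re_sigma_level_strict_mono[of "Re \<zeta>" "Re \<zeta>'" c] Re_sigma_level_strict_mono[of "Re \<zeta>'" "Re \<zeta>" c] assms
    by (metis less_irrefl linorder_neqE_linordered_idom)
  ultimately show ?thesis by metis
qed

lemma exp_form_inj_on:
  assumes f: "exp_form k A B f"
  shows "inj_on f unit_disc"
proof (rule inj_onI)
  fix z z' assume z: "z \<in> unit_disc" and z': "z' \<in> unit_disc" and eq: "f z = f z'"
  show "z = z'"
  proof (cases "z = 0 \<or> z' = 0")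
    case True
    then show ?thesis using eq by (auto simp: exp_formD[OF f z] exp_formD[OF f z'])
  next
    case False
    define \<zeta> where "\<zeta> = Ln z"
    define \<zeta>' where "\<zeta>' = Ln z'"
    have e: "exp \<zeta> = z" "exp \<zeta>' = z'" and neg: "Re \<zeta> < 0" "Re \<zeta>' < 0"
      using False z z' by (auto simp: \<zeta>_def \<zeta>'_def)
    have l: "lift \<zeta> = z ^ k" "lift \<zeta>' = z' ^ k"
      by (simp_all add: lift_def exp_of_nat_mult e)
    have "f z = exp (\<zeta> + A (z ^ k) + cnj (B (z ^ k)))" "f z' = exp (\<zeta>' + A (z' ^ k) + cnj (B (z' ^ k)))"
      by (simp_all add: exp_formD[OF f z] exp_formD[OF f z'] exp_add e exp_cnj)
    then have "exp (\<zeta> + A (z ^ k) + cnj (B (z ^ k))) = exp (\<zeta>' + A (z' ^ k) + cnj (B (z' ^ k)))"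
      using eq by simp
    then obtain n :: int where n: "\<zeta> + A (z ^ k) + cnj (B (z ^ k))
        = \<zeta>' + A (z' ^ k) + cnj (B (z' ^ k)) + of_real (of_int (2 * n) * pi) * \<i>"
      unfolding exp_eq by blast
    \<comment> \<open>The two logarithms may differ by a multiple of 2 pi i. Shifting one preimage
      by it leaves \<open>exp\<close> and \<open>lift\<close> unchanged and makes the logarithms
      equal.\<close>
    define \<xi> where "\<xi> = \<zeta>' + of_real (of_int (2 * n) * pi) * \<i>"
    have ex: "exp \<xi> = z'"
      using exp_eq[of \<xi> \<zeta>'] by (auto simp: \<xi>_def e)
    then have lx: "lift \<xi> = z' ^ k"
      by (simp add: lift_def exp_of_nat_mult)
    have n': "\<zeta> + A (z ^ k) + cnj (B (z ^ k)) = \<xi> + A (z' ^ k) + cnj (B (z' ^ k))"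
      using n by (simp add: \<xi>_def algebra_simps)
    have "\<zeta> = \<xi>"
    proof (rule level_set_injective)
      show "Re \<xi> < 0" using neg by (simp add: \<xi>_def)
      show "Im (\<psi> \<zeta>) = Im (\<psi> \<xi>)" using arg_cong[OF n', of Im] by (simp add: \<psi>_def l lx)
      show "Re (\<sigma> \<zeta>) = Re (\<sigma> \<xi>)" using arg_cong[OF n', of Re] by (simp add: \<sigma>_def l lx)
    qed (rule neg)
    then show ?thesis using e ex by simp
  qed
qed

end

section \<open>The Bohr inequality\<close>

context starlike_logarithms
begin

section \<open>Exponential forms as starlike logharmonic mappings\<close>

lemma exp_form_dilatation:
  assumes f: "exp_form k A B f"
  shows "second_dilatation f (\<lambda>z. W (z ^ k))"
  unfolding second_dilatation_def
proof (intro conjI ballI impI)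
  have "W \<circ> (\<lambda>z. z ^ k) holomorphic_on unit_disc"
    by (rule holomorphic_on_compose_gen[OF _ W(1)])
       (use power_in_unit_disc[OF k] in \<open>auto intro!: holomorphic_intros\<close>)
  then show "(\<lambda>z. W (z ^ k)) holomorphic_on unit_disc" by (simp add: o_def)
  fix z assume z: "z \<in> unit_disc"
  show "norm (W (z ^ k)) < 1" using power_in_unit_disc[OF k z] by (rule W1)
  assume fz: "f z \<noteq> 0"
  then have z0: "z \<noteq> 0" using exp_formD[OF f z] by auto
  note wf = wirtinger_exp_form(2,3)[OF k A(1) B(1) f z]
  have "z * cnj (wirtinger_zbar f z) = cnj (f z) * (of_nat k * z ^ k * deriv B (z ^ k))"
    using arg_cong[OF wf(2), of cnj] by simp
  also have "\<dots> = cnj (f z) * (W (z ^ k) * (1 + of_nat k * z ^ k * deriv A (z ^ k)))"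
    using dilatation[OF power_in_unit_disc[OF k z]] by simp
  finally have "z * cnj (wirtinger_zbar f z) / cnj (f z) = W (z ^ k) * (1 + of_nat k * z ^ k * deriv A (z ^ k))"
    using fz by simp
  moreover have "z * wirtinger_z f z / f z = 1 + of_nat k * z ^ k * deriv A (z ^ k)"
    using wf(1) fz by simp
  ultimately have "z * cnj (wirtinger_zbar f z) / cnj (f z) = W (z ^ k) * (z * wirtinger_z f z / f z)"
    by (simp only:)
  then have "z * (cnj (wirtinger_zbar f z) / cnj (f z)) = z * (W (z ^ k) * (wirtinger_z f z / f z))"
    by (metis times_divide_eq_right mult.left_commute)
  then show "cnj (wirtinger_zbar f z) / cnj (f z) = W (z ^ k) * (wirtinger_z f z / f z)"
    using z0 mult_left_cancel by blast
qed

lemma exp_form_starlike: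
  assumes f: "exp_form k A B f"
  shows "starlike_of_order \<alpha> f"
proof -
  define q where "q = (\<lambda>z. (z * wirtinger_z f z - cnj z * wirtinger_zbar f z) / f z)"
  define c where "c = (\<lambda>z. 1 + of_nat k * z ^ k * deriv A (z ^ k) - cnj (of_nat k * z ^ k * deriv B (z ^ k)))"
  have q: "q z = c z" if z: "z \<in> unit_disc" "z \<noteq> 0" for z
  proof -
    have "f z \<noteq> 0" using z by (simp add: exp_formD[OF f])
    then show ?thesis
      unfolding q_def c_def wirtinger_exp_form(2,3)[OF k A(1) B(1) f z(1)]
      by (simp add: right_diff_distrib[symmetric])
  qed
  have "\<alpha> < Re (q z)" if z: "z \<in> unit_disc - {0}" for z
  proof -
    have "Re (c z) = Re (1 + of_nat k * z ^ k * deriv A (z ^ k) - of_nat k * z ^ k * deriv B (z ^ k))"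
      unfolding c_def by (simp only: minus_complex.sel cnj.sel)
    moreover have zd: "z \<in> unit_disc" and "q z = c z"
      using z by (auto intro!: q)
    ultimately show ?thesis
      using starlike[OF power_in_unit_disc[OF k zd]] by (simp only:)
  qed
  moreover have "(q \<longlongrightarrow> 1) (at 0)"
  proof (rule Lim_transform_within_open)
    have cont: "isCont (deriv A) 0" "isCont (deriv B) 0"
      using deriv_hol by (auto intro!: holomorphic_on_imp_continuous_on continuous_on_interior)
    have pow: "((\<lambda>z. z ^ k) \<longlongrightarrow> 0) (at (0::complex))"
    proof (rule tendsto_eq_rhs[OF tendsto_power[OF tendsto_ident_at]])
      show "(0::complex) ^ k = 0" using k by simp
    qed
    have "((\<lambda>z. deriv A (z ^ k)) \<longlongrightarrow> deriv A 0) (at 0)" "((\<lambda>z. deriv B (z ^ k)) \<longlongrightarrow> deriv B 0) (at 0)"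
      using cont pow by (auto intro: isCont_tendsto_compose)
    then have "(c \<longlongrightarrow> 1 + of_nat k * 0 * deriv A 0 - cnj (of_nat k * 0 * deriv B 0)) (at 0)"
      unfolding c_def using pow by (intro tendsto_intros)
    then show "(c \<longlongrightarrow> 1) (at 0)" by simp
    show "open unit_disc" "0 \<in> unit_disc" by auto
  qed (simp add: q)
  ultimately show ?thesis
    using \<alpha> by (auto simp: starlike_of_order_def q_def Let_def intro!: exI[of _ 1])
qed

lemma exp_form_logharmonic:
  assumes f: "exp_form k A B f"
  shows "logharmonic f"
  unfolding logharmonic_def
  using wirtinger_exp_form(1)[OF k A(1) B(1) f] exp_form_dilatation[OF f]
  by (auto intro!: continuous_at_imp_continuous_on differentiable_imp_continuous_within)

lemma exp_form_fold_symmetric: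
  assumes f: "exp_form k A B f"
  shows "fold_symmetric k f"
  unfolding fold_symmetric_def
proof
  fix z assume z: "z \<in> unit_disc"
  define \<epsilon> where "\<epsilon> = exp (2 * of_real pi * \<i> / of_nat k)"
  have "\<epsilon> ^ k = exp (of_nat k * (2 * of_real pi * \<i> / of_nat k))"
    unfolding \<epsilon>_def by (rule exp_of_nat_mult[symmetric])
  also have "of_nat k * (2 * of_real pi * \<i> / of_nat k) = 2 * of_real pi * \<i>"
    using k by simp
  finally have "\<epsilon> ^ k = 1" by simp
  moreover have "norm \<epsilon> = 1"
    by (simp add: \<epsilon>_def)
  then have "\<epsilon> * z \<in> unit_disc" using z by (simp add: norm_mult)
  ultimately have "f (\<epsilon> * z) = \<epsilon> * f z"
    using z by (simp only: exp_formD[OF f] power_mult_distrib mult.assoc) simp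
  then show "f (exp (2 * of_real pi * \<i> / of_nat k) * z) = exp (2 * of_real pi * \<i> / of_nat k) * f z"
    by (simp only: \<epsilon>_def)
qed

lemma exp_form_norm:
  assumes f: "exp_form k A B f"
    and z: "z \<in> unit_disc"
  shows "norm (f z) = norm z * exp (Re (A (z ^ k) + B (z ^ k)))"
  by (simp add: exp_formD[OF f z] norm_mult exp_add)

section \<open>Boundary distance against the majorant\<close>

lemma covering_radius_le_infdist:
  assumes f: "exp_form k A B f"
  shows "covering_radius k \<alpha> \<le> infdist (f 0) (frontier (f ` unit_disc))"
proof -
  note inj = exp_form_inj_on[OF f]
  have cont: "continuous_on unit_disc f"
    using exp_form_logharmonic[OF f] by (simp add: logharmonic_def)
  have hol: "(\<lambda>z. F (z ^ k)) holomorphic_on unit_disc" if "F holomorphic_on unit_disc" for F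
    using holomorphic_on_compose_gen[of "\<lambda>z. z ^ k" unit_disc F unit_disc] that power_in_unit_disc[OF k]
    by (force simp: o_def intro!: holomorphic_intros)
  \<comment> \<open>\<open>infdist\<close> to the empty set is 0 by convention, which would defeat
    the lower bound.\<close>
  have ne: "frontier (f ` unit_disc) \<noteq> {}"
  proof (rule frontier_image_nonempty[OF inj cont])
    show "(\<lambda>z. A (z ^ k) + B (z ^ k)) holomorphic_on unit_disc"
      by (intro holomorphic_intros hol A B)
    show "A (0 ^ k) + B (0 ^ k) = 0" using k A B by (simp add: power_0_left)
  qed (rule exp_form_norm[OF f])
  have "norm z * covering_radius k \<alpha> \<le> norm (f z)" if z: "z \<in> unit_disc" for z
    unfolding exp_form_norm[OF f z] covering_radius_def
    using Re_sum_ge[of "z ^ k"] power_in_unit_disc[OF k z] by (intro mult_left_mono) auto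
  then have "covering_radius k \<alpha> \<le> norm w" if "w \<in> frontier (f ` unit_disc)" for w
    using that frontier_image_norm_ge[OF inj cont covering_radius_pos] by blast
  moreover have "f 0 = 0" using exp_formD[OF f, of 0] by simp
  ultimately show ?thesis
    using ne by (auto simp: infdist_notempty intro!: cINF_greatest)
qed

lemma bohr_sum_le_majorant:
  assumes f: "exp_form k A B f"
    and FA: "A has_fps_expansion FA" "\<And>n. fps_nth FA (Suc n) = a (Suc n * k)"
    and FB: "B has_fps_expansion FB" "\<And>n. fps_nth FB (Suc n) = b (Suc n * k)"
    and z: "z \<in> unit_disc"
  shows "norm (z * wirtinger_z f z)
       + norm z * exp (\<Sum>n. norm (a (Suc n * k) + exp (\<i> * of_real \<theta>) * b (Suc n * k)) * norm z ^ (Suc n * k))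
     \<le> bohr_majorant k \<alpha> (norm z)"
proof -
  define s where "s = norm z ^ k"
  have s: "0 \<le> s" "s < 1" and zk: "norm (z ^ k) = s"
    using power_in_unit_disc[OF k z] by (auto simp: s_def norm_power)
  have pow: "norm z ^ (Suc n * k) = s ^ Suc n" for n
    unfolding s_def by (metis power_mult mult.commute)
  have 1: "exp (\<Sum>n. norm (a (Suc n * k) + exp (\<i> * of_real \<theta>) * b (Suc n * k)) * norm z ^ (Suc n * k))
      \<le> exp (growth_exponent k \<alpha> s)"
    using coeff_sum_le[OF FA(1) FB(1), of "exp (\<i> * of_real \<theta>)" s] s unfolding pow FA(2) FB(2) by simp
  have "norm (z * wirtinger_z f z) = norm (f z) * norm (1 + of_nat k * z ^ k * deriv A (z ^ k))"
    unfolding wirtinger_exp_form(2)[OF k A(1) B(1) f z] by (rule norm_mult)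
  also have "norm (f z) \<le> norm z * exp (growth_exponent k \<alpha> s)"
    unfolding exp_form_norm[OF f z] using Re_sum_le[of "z ^ k"] s by (intro mult_left_mono) (auto simp: zk)
  also have "norm (1 + of_nat k * z ^ k * deriv A (z ^ k)) \<le> (1 + (1 - 2 * \<alpha>) * s) / (1 - s)\<^sup>2"
    using norm_one_plus_deriv_le[of "z ^ k"] s by (simp add: zk)
  finally have 2: "norm (z * wirtinger_z f z) \<le> norm z * exp (growth_exponent k \<alpha> s) * ((1 + (1 - 2 * \<alpha>) * s) / (1 - s)\<^sup>2)"
    by (simp add: mult_left_mono mult_right_mono)
  have "norm (z * wirtinger_z f z)
       + norm z * exp (\<Sum>n. norm (a (Suc n * k) + exp (\<i> * of_real \<theta>) * b (Suc n * k)) * norm z ^ (Suc n * k))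
     \<le> norm z * exp (growth_exponent k \<alpha> s) * ((1 + (1 - 2 * \<alpha>) * s) / (1 - s)\<^sup>2)
        + norm z * exp (growth_exponent k \<alpha> s)"
    using 1 2 by (intro add_mono mult_left_mono) auto
  then show ?thesis
    unfolding bohr_majorant_def s_def[symmetric] by (simp add: distrib_left)
qed

end

lemma bohr_inequality_of_majorant:
  assumes k: "1 \<le> k" and \<alpha>: "0 \<le> \<alpha>" "\<alpha> < 1"
    and f: "f \<in> starlike_logharmonic k \<alpha>" and rep: "logharmonic_representation k f h g a b"
    and \<omega>: "second_dilatation f \<omega>"
    and z: "z \<in> unit_disc" and le: "bohr_majorant k \<alpha> (norm z) \<le> covering_radius k \<alpha>"
  shows "bohr_inequality k f a b \<theta> z"
proof -
  have h: "exp_lacunary_series k a h" and g: "exp_lacunary_series k b g"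
    and fz: "\<And>z. z \<in> unit_disc \<Longrightarrow> f z = z * h z * cnj (g z)"
    using rep by (auto simp: logharmonic_representation_def)
  obtain A FA where sA: "A holomorphic_on unit_disc" "A 0 = 0" "A has_fps_expansion FA"
    "\<And>n. fps_nth FA (Suc n) = a (Suc n * k)" and hA: "\<And>z. z \<in> unit_disc \<Longrightarrow> h z = exp (A (z ^ k))"
    using exp_lacunary_seriesE[OF h k] by blast
  obtain B FB where sB: "B holomorphic_on unit_disc" "B 0 = 0" "B has_fps_expansion FB"
    "\<And>n. fps_nth FB (Suc n) = b (Suc n * k)" and gB: "\<And>z. z \<in> unit_disc \<Longrightarrow> g z = exp (B (z ^ k))"
    using exp_lacunary_seriesE[OF g k] by blast
  have form: "exp_form k A B f"
    by (simp add: exp_form_def fz hA gB)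
  have "starlike_of_order \<alpha> f" using f by (simp add: starlike_logharmonic_def)
  then interpret starlike_logarithms k \<alpha> A B "\<lambda>s. of_nat k * s * deriv B s / (1 + of_nat k * s * deriv A s)"
    by (rule starlike_logarithmsI[OF k \<alpha> sA(1,2) sB(1,2) form \<omega>])
  show ?thesis
    unfolding bohr_inequality_def
    using bohr_sum_le_majorant[OF form sA(3,4) sB(3,4) z] le covering_radius_le_infdist[OF form]
    by (meson order_trans)
qed

section \<open>The extremal mapping\<close>

text \<open>Obtained by integrating \<open>1 + k * s * A' = p / (1 - s)\<close> and
  \<open>k * s * B' = s * p / (1 - s)\<close> with
  \<open>p = (1 + (1 - 2 * \<alpha>) * s) / (1 - s)\<close>; then \<open>P\<close> and
  \<open>Q\<close> are both \<open>(1 + s) / (1 - s)\<close>.\<close>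

definition extremal_A :: "nat \<Rightarrow> real \<Rightarrow> complex \<Rightarrow> complex" where
  "extremal_A k \<alpha> s = (of_real (2 * (1 - \<alpha>)) * (s / (1 - s)) - Ln (1 - s)) / of_nat k"

definition extremal_B :: "nat \<Rightarrow> real \<Rightarrow> complex \<Rightarrow> complex" where
  "extremal_B k \<alpha> s = (of_real (2 * (1 - \<alpha>)) * (s / (1 - s)) + of_real (1 - 2 * \<alpha>) * Ln (1 - s)) / of_nat k"

definition extremal :: "nat \<Rightarrow> real \<Rightarrow> complex \<Rightarrow> complex" where
  "extremal k \<alpha> z = z * exp (extremal_A k \<alpha> (z ^ k)) * cnj (exp (extremal_B k \<alpha> (z ^ k)))"

text \<open>The series reads the sequence at \<open>m = n * k\<close>, where \<open>m div k\<close>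
  recovers \<open>n\<close>.\<close>

definition extremal_a :: "nat \<Rightarrow> real \<Rightarrow> nat \<Rightarrow> complex" where
  "extremal_a k \<alpha> m = (of_real (2 * (1 - \<alpha>)) + 1 / of_nat (m div k)) / of_nat k"

definition extremal_b :: "nat \<Rightarrow> real \<Rightarrow> nat \<Rightarrow> complex" where
  "extremal_b k \<alpha> m = (of_real (2 * (1 - \<alpha>)) - of_real (1 - 2 * \<alpha>) / of_nat (m div k)) / of_nat k"

lemma extremal_exp_form: "exp_form k (extremal_A k \<alpha>) (extremal_B k \<alpha>) (extremal k \<alpha>)"
  by (simp add: exp_form_def extremal_def)

lemma one_minus_nonpos: "norm s < 1 \<Longrightarrow> 1 - s \<notin> \<real>\<^sub>\<le>\<^sub>0" for s :: complex
  using abs_Re_le_cmod[of s] by (auto simp: complex_nonpos_Reals_iff)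

lemma extremal_deriv:
  assumes k: "1 \<le> k" and s: "norm s < 1"
  shows "(extremal_A k \<alpha> has_field_derivative
            (of_real (2 * (1 - \<alpha>)) / (1 - s)\<^sup>2 + 1 / (1 - s)) / of_nat k) (at s)"
    and "(extremal_B k \<alpha> has_field_derivative
            (of_real (2 * (1 - \<alpha>)) / (1 - s)\<^sup>2 - of_real (1 - 2 * \<alpha>) / (1 - s)) / of_nat k) (at s)"
proof -
  have s1: "1 - s \<noteq> 0" using s by auto
  have 1: "((\<lambda>s. s / (1 - s)) has_field_derivative 1 / (1 - s)\<^sup>2) (at s)"
    using s1 by (auto intro!: derivative_eq_intros simp: field_simps power2_eq_square)
  have 2: "((\<lambda>s. Ln (1 - s)) has_field_derivative - (1 / (1 - s))) (at s)"
    using s1 one_minus_nonpos[OF s] by (auto intro!: derivative_eq_intros simp: field_simps)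
  show "(extremal_A k \<alpha> has_field_derivative
            (of_real (2 * (1 - \<alpha>)) / (1 - s)\<^sup>2 + 1 / (1 - s)) / of_nat k) (at s)"
    unfolding extremal_A_def
    by (rule DERIV_cong[OF DERIV_cdivide[OF DERIV_diff[OF DERIV_cmult[OF 1] 2]]]) simp
  show "(extremal_B k \<alpha> has_field_derivative
            (of_real (2 * (1 - \<alpha>)) / (1 - s)\<^sup>2 - of_real (1 - 2 * \<alpha>) / (1 - s)) / of_nat k) (at s)"
    unfolding extremal_B_def
    by (rule DERIV_cong[OF DERIV_cdivide[OF DERIV_add[OF DERIV_cmult[OF 1] DERIV_cmult[OF 2]]]]) simp
qed

lemma extremal_deriv_eq:
  assumes k: "1 \<le> k" and s: "norm s < 1"
  shows "1 + of_nat k * s * deriv (extremal_A k \<alpha>) s = (1 + of_real (1 - 2 * \<alpha>) * s) / (1 - s)\<^sup>2"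
    and "of_nat k * s * deriv (extremal_B k \<alpha>) s = s * ((1 + of_real (1 - 2 * \<alpha>) * s) / (1 - s)\<^sup>2)"
proof -
  \<comment> \<open>In terms of \<open>d\<close> all denominators are powers of one variable, and
    the identities become polynomial.\<close>
  define d where "d = 1 - s"
  have d: "d \<noteq> 0" and sd: "s = 1 - d" using s by (auto simp: d_def)
  have k0: "of_nat k \<noteq> (0::complex)" using k by simp
  show "1 + of_nat k * s * deriv (extremal_A k \<alpha>) s = (1 + of_real (1 - 2 * \<alpha>) * s) / (1 - s)\<^sup>2"
    unfolding DERIV_imp_deriv[OF extremal_deriv(1)[OF k s]] d_def[symmetric]
    using d k0 by (simp add: sd divide_simps) (simp add: algebra_simps power2_eq_square)
  show "of_nat k * s * deriv (extremal_B k \<alpha>) s = s * ((1 + of_real (1 - 2 * \<alpha>) * s) / (1 - s)\<^sup>2)"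
    unfolding DERIV_imp_deriv[OF extremal_deriv(2)[OF k s]] d_def[symmetric]
    using d k0 by (simp add: sd divide_simps) (simp add: algebra_simps power2_eq_square)
qed

lemma extremal_starlike_logarithms:
  assumes k: "1 \<le> k" and \<alpha>: "0 \<le> \<alpha>" "\<alpha> < 1"
  shows "starlike_logarithms k \<alpha> (extremal_A k \<alpha>) (extremal_B k \<alpha>) (\<lambda>s. s)"
proof
  show "extremal_A k \<alpha> holomorphic_on unit_disc" "extremal_B k \<alpha> holomorphic_on unit_disc"
    unfolding holomorphic_on_open[OF open_ball] using extremal_deriv[OF k] by (metis mem_ball_0)+
  show "of_nat k * s * deriv (extremal_B k \<alpha>) s = s * (1 + of_nat k * s * deriv (extremal_A k \<alpha>) s)"
    if "s \<in> unit_disc" for s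
    using that by (simp only: extremal_deriv_eq[OF k] dist_0_norm mem_ball)
  show "\<alpha> < Re (1 + of_nat k * s * deriv (extremal_A k \<alpha>) s - of_nat k * s * deriv (extremal_B k \<alpha>) s)"
    if "s \<in> unit_disc" for s
  proof -
    have s: "norm s < 1" and s1: "1 - s \<noteq> 0" using that by auto
    have "1 + of_nat k * s * deriv (extremal_A k \<alpha>) s - of_nat k * s * deriv (extremal_B k \<alpha>) s
        = (1 - s) * ((1 + of_real (1 - 2 * \<alpha>) * s) / (1 - s)\<^sup>2)"
      unfolding extremal_deriv_eq[OF k s] left_diff_distrib mult_1_left ..
    also have "\<dots> = (1 + of_real (1 - 2 * \<alpha>) * s) / (1 - s)"
      using s1 by (simp add: power2_eq_square)
    also have "\<dots> = 1 + of_real (2 * (1 - \<alpha>)) * (s / (1 - s))"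
      using s1 by (simp add: field_simps)
    finally have eq: "1 + of_nat k * s * deriv (extremal_A k \<alpha>) s - of_nat k * s * deriv (extremal_B k \<alpha>) s
        = 1 + of_real (2 * (1 - \<alpha>)) * (s / (1 - s))" .
    have "Re (1 + of_real c * w) = 1 + c * Re w" for c w by simp
    then have "Re (1 + of_nat k * s * deriv (extremal_A k \<alpha>) s - of_nat k * s * deriv (extremal_B k \<alpha>) s)
        = 1 + 2 * (1 - \<alpha>) * Re (s / (1 - s))"
      unfolding eq .
    moreover have "2 * (1 - \<alpha>) * (-1/2) < 2 * (1 - \<alpha>) * Re (s / (1 - s))"
      using \<alpha> Re_div_one_minus[OF s] by (intro mult_strict_left_mono) auto
    ultimately show ?thesis by (simp add: algebra_simps)
  qed
qed (use assms in \<open>auto simp: extremal_A_def extremal_B_def\<close>)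

lemma extremal_sums:
  assumes k: "1 \<le> k" and z: "z \<in> unit_disc"
  shows "(\<lambda>n. extremal_a k \<alpha> (Suc n * k) * z ^ (Suc n * k)) sums extremal_A k \<alpha> (z ^ k)"
    and "(\<lambda>n. extremal_b k \<alpha> (Suc n * k) * z ^ (Suc n * k)) sums extremal_B k \<alpha> (z ^ k)"
proof -
  define s where "s = z ^ k"
  have s: "norm s < 1" using power_in_unit_disc[OF k z] by (simp add: s_def)
  have pow: "z ^ (Suc n * k) = s ^ Suc n" for n
    unfolding s_def by (metis power_mult mult.commute)
  have dv: "Suc n * k div k = Suc n" for n using k by simp
  have 1: "(\<lambda>n. s ^ Suc n) sums (s / (1 - s))"
    using sums_mult[OF geometric_sums[OF s], of s] by simp
  have "(\<lambda>n. - ((- (- s)) ^ n) / of_nat n) sums Ln (1 + (- s))"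
    using s by (intro Ln_series') auto
  then have 2: "(\<lambda>n. - (s ^ Suc n) / of_nat (Suc n)) sums Ln (1 - s)"
    by (subst sums_Suc_iff) simp
  have "(\<lambda>n. (of_real (2 * (1 - \<alpha>)) * s ^ Suc n - (- (s ^ Suc n) / of_nat (Suc n))) / of_nat k) sums extremal_A k \<alpha> s"
    unfolding extremal_A_def by (intro sums_divide sums_diff sums_mult 1 2)
  then show "(\<lambda>n. extremal_a k \<alpha> (Suc n * k) * z ^ (Suc n * k)) sums extremal_A k \<alpha> (z ^ k)"
    unfolding extremal_a_def pow dv s_def[symmetric]
    by (rule sums_cong[THEN iffD1, rotated]) (simp add: divide_inverse algebra_simps del: of_nat_Suc)
  have "(\<lambda>n. (of_real (2 * (1 - \<alpha>)) * s ^ Suc n + of_real (1 - 2 * \<alpha>) * (- (s ^ Suc n) / of_nat (Suc n))) / of_nat k) sums extremal_B k \<alpha> s"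
    unfolding extremal_B_def by (intro sums_divide sums_add sums_mult 1 2)
  then show "(\<lambda>n. extremal_b k \<alpha> (Suc n * k) * z ^ (Suc n * k)) sums extremal_B k \<alpha> (z ^ k)"
    unfolding extremal_b_def pow dv s_def[symmetric]
    by (rule sums_cong[THEN iffD1, rotated]) (simp add: divide_inverse algebra_simps del: of_nat_Suc)
qed

lemma extremal_representation:
  assumes k: "1 \<le> k" and \<alpha>: "0 \<le> \<alpha>" "\<alpha> < 1"
  shows "logharmonic_representation k (extremal k \<alpha>)
     (\<lambda>z. exp (extremal_A k \<alpha> (z ^ k))) (\<lambda>z. exp (extremal_B k \<alpha> (z ^ k))) (extremal_a k \<alpha>) (extremal_b k \<alpha>)"
proof -
  interpret starlike_logarithms k \<alpha> "extremal_A k \<alpha>" "extremal_B k \<alpha>" "\<lambda>s. s"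
    by (rule extremal_starlike_logarithms[OF k \<alpha>])
  have hol: "(\<lambda>z. exp (F (z ^ k))) holomorphic_on unit_disc" if "F holomorphic_on unit_disc" for F
    using holomorphic_on_compose_gen[of "\<lambda>z. z ^ k" unit_disc F unit_disc] that power_in_unit_disc[OF k]
    by (force simp: o_def intro!: holomorphic_intros)
  show ?thesis
    unfolding logharmonic_representation_def exp_lacunary_series_def
    using hol[OF A(1)] hol[OF B(1)] extremal_sums[OF k]
    by (simp add: extremal_def sums_iff)
qed

lemma extremal_mem:
  assumes k: "1 \<le> k" and \<alpha>: "0 \<le> \<alpha>" "\<alpha> < 1"
  shows "extremal k \<alpha> \<in> starlike_logharmonic k \<alpha>"
    and "second_dilatation (extremal k \<alpha>) (\<lambda>z. z ^ k)"
proof -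
  interpret starlike_logarithms k \<alpha> "extremal_A k \<alpha>" "extremal_B k \<alpha>" "\<lambda>s. s"
    by (rule extremal_starlike_logarithms[OF k \<alpha>])
  note f = extremal_exp_form[of k \<alpha>]
  show "second_dilatation (extremal k \<alpha>) (\<lambda>z. z ^ k)"
    by (rule exp_form_dilatation[OF f])
  show "extremal k \<alpha> \<in> starlike_logharmonic k \<alpha>"
    unfolding starlike_logharmonic_def
    using exp_form_inj_on[OF f] exp_form_logharmonic[OF f] exp_form_fold_symmetric[OF f]
      exp_form_starlike[OF f] extremal_representation[OF k \<alpha>] by blast
qed

text \<open>It suffices to exhibit one frontier point of that modulus: the radial limit at a point
  \<open>\<zeta>\<close> of the unit circle with \<open>\<zeta> ^ k = -1\<close>, where both factors
  attain the minimum in the lower bound.\<close>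

lemma extremal_infdist_le:
  assumes k: "1 \<le> k" and \<alpha>: "0 \<le> \<alpha>" "\<alpha> < 1"
  shows "infdist (extremal k \<alpha> 0) (frontier (extremal k \<alpha> ` unit_disc)) \<le> covering_radius k \<alpha>"
proof -
  interpret starlike_logarithms k \<alpha> "extremal_A k \<alpha>" "extremal_B k \<alpha>" "\<lambda>s. s"
    by (rule extremal_starlike_logarithms[OF k \<alpha>])
  define f where "f = extremal k \<alpha>"
  have form: "exp_form k (extremal_A k \<alpha>) (extremal_B k \<alpha>) f"
    unfolding f_def by (rule extremal_exp_form)
  note inj = exp_form_inj_on[OF form]
  have cont: "continuous_on unit_disc f"
    using exp_form_logharmonic[OF form] by (simp add: logharmonic_def)
  define \<zeta> where "\<zeta> = exp (of_real pi * \<i> / of_nat k)"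
  have n\<zeta>: "norm \<zeta> = 1" by (simp add: \<zeta>_def)
  have "\<zeta> ^ k = exp (of_nat k * (of_real pi * \<i> / of_nat k))"
    unfolding \<zeta>_def by (rule exp_of_nat_mult[symmetric])
  also have "of_nat k * (of_real pi * \<i> / of_nat k) = of_real pi * \<i>"
    using k by simp
  finally have \<zeta>k: "\<zeta> ^ k = -1" by simp
  define \<gamma> where "\<gamma> = (\<lambda>\<rho>::real. of_real \<rho> * \<zeta>)"
  have lim: "(\<gamma> \<longlongrightarrow> \<zeta>) (at_left 1)"
    unfolding \<gamma>_def by (auto intro!: tendsto_eq_intros)
  have in_disc: "\<forall>\<^sub>F \<rho> in at_left 1. \<gamma> \<rho> \<in> unit_disc"
    using eventually_at_left_real[of 0 "1::real"] by (auto elim!: eventually_mono simp: \<gamma>_def norm_mult n\<zeta>)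
  \<comment> \<open>The defining formula also makes sense outside the disc; near
    \<open>\<zeta>\<close> it is continuous, because \<open>1 - \<zeta> ^ k = 2\<close> stays away
    from the branch cut.\<close>
  define w where "w = f \<zeta>"
  have two: "1 - \<zeta> ^ k = 2" using \<zeta>k by simp
  have "isCont f \<zeta>"
  proof -
    define L where "L = (\<lambda>z::complex. Ln (1 - z ^ k))"
    define D where "D = (\<lambda>z::complex. z ^ k / (1 - z ^ k))"
    have L: "isCont L \<zeta>"
      unfolding L_def by (intro continuous_intros) (simp add: two)
    have D: "isCont D \<zeta>"
      unfolding D_def by (intro continuous_intros) (simp add: two)
    have k0: "of_nat k \<noteq> (0::complex)" using k by simp
    have "f = (\<lambda>z. z * exp ((of_real (2 * (1 - \<alpha>)) * D z - L z) / of_nat k)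
        * cnj (exp ((of_real (2 * (1 - \<alpha>)) * D z + of_real (1 - 2 * \<alpha>) * L z) / of_nat k)))"
      by (simp add: f_def extremal_def extremal_A_def extremal_B_def L_def D_def fun_eq_iff)
    then show ?thesis
      by (simp only:) (intro isCont_mult continuous_ident isCont_cnj isCont_exp' isCont_divide isCont_diff isCont_add
          continuous_const L D k0)
  qed
  then have flim: "((\<lambda>\<rho>. f (\<gamma> \<rho>)) \<longlongrightarrow> w) (at_left 1)"
    unfolding w_def using lim by (rule isCont_tendsto_compose)
  have nw: "norm w = covering_radius k \<alpha>"
  proof -
    have "norm w = exp (Re (extremal_A k \<alpha> (-1) + extremal_B k \<alpha> (-1)))"
      by (simp add: w_def f_def extremal_def \<zeta>k n\<zeta> norm_mult exp_add)
    also have "extremal_A k \<alpha> (-1) + extremal_B k \<alpha> (-1) = of_real ((- 2 * (1 - \<alpha>) - 2 * \<alpha> * ln 2) / k)"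
    proof -
      have ln2: "Ln 2 = of_real (ln 2)" using Ln_of_real[of 2] by simp
      have 1: "extremal_A k \<alpha> (-1) = of_real ((- (1 - \<alpha>) - ln 2) / k)"
        and 2: "extremal_B k \<alpha> (-1) = of_real ((- (1 - \<alpha>) + (1 - 2 * \<alpha>) * ln 2) / k)"
        by (simp_all add: extremal_A_def extremal_B_def ln2 diff_divide_distrib)
      show ?thesis
        unfolding 1 2 of_real_add[symmetric] add_divide_distrib[symmetric]
        by (rule arg_cong[where f = "\<lambda>x. of_real (x / k)"]) (simp add: algebra_simps)
    qed
    finally show ?thesis by (simp add: covering_radius_def)
  qed
  have "w \<in> closure (f ` unit_disc)"
  proof (rule Lim_in_closed_set[OF closed_closure _ _ flim])
    show "\<forall>\<^sub>F \<rho> in at_left 1. f (\<gamma> \<rho>) \<in> closure (f ` unit_disc)"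
      using in_disc by eventually_elim (use closure_subset in blast)
  qed simp
  \<comment> \<open>If \<open>w\<close> were attained, the continuous inverse would carry the radial
    limit to a point of the open disc, while the radius itself tends to \<open>\<zeta>\<close> of
    modulus 1.\<close>
  moreover have "w \<notin> f ` unit_disc"
  proof
    assume w: "w \<in> f ` unit_disc"
    have op: "open (f ` unit_disc)"
      using invariance_of_domain[OF cont open_ball inj] .
    obtain g where g: "homeomorphism unit_disc (f ` unit_disc) f g"
      using invariance_of_domain_homeomorphism[OF open_ball cont _ inj] by auto
    have "isCont g w"
      using g op w by (auto simp: homeomorphism_def continuous_on_eq_continuous_at)
    then have "((\<lambda>\<rho>. g (f (\<gamma> \<rho>))) \<longlongrightarrow> g w) (at_left 1)"
      using flim by (rule isCont_tendsto_compose)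
    moreover have "\<forall>\<^sub>F \<rho> in at_left 1. g (f (\<gamma> \<rho>)) = \<gamma> \<rho>"
      using in_disc by eventually_elim (use g in \<open>auto simp: homeomorphism_def\<close>)
    ultimately have "(\<gamma> \<longlongrightarrow> g w) (at_left 1)"
      by (rule Lim_transform_eventually)
    then have "g w = \<zeta>"
      using lim tendsto_unique trivial_limit_at_left_real by blast
    moreover have "g w \<in> unit_disc"
      using g w by (auto simp: homeomorphism_def)
    ultimately show False using n\<zeta> by simp
  qed
  ultimately have "w \<in> frontier (f ` unit_disc)"
    using interior_subset by (auto simp: frontier_def)
  then have "infdist (f 0) (frontier (f ` unit_disc)) \<le> dist (f 0) w"
    by (rule infdist_le)
  also have "f 0 = 0"
    using exp_formD[OF form, of 0] by simp
  finally show ?thesis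
    using \<open>f 0 = 0\<close> by (simp add: nw f_def)
qed

text \<open>On the positive real axis with \<open>\<theta> = 0\<close> all coefficients and factors
  are nonnegative reals, so each estimate behind the majorant is an equality.\<close>

lemma extremal_bohr_sum:
  assumes k: "1 \<le> k" and \<alpha>: "0 \<le> \<alpha>" "\<alpha> < 1" and r: "0 \<le> r" "r < 1"
  shows "norm (of_real r * wirtinger_z (extremal k \<alpha>) (of_real r))
     + r * exp (\<Sum>n. norm (extremal_a k \<alpha> (Suc n * k) + exp (\<i> * of_real 0) * extremal_b k \<alpha> (Suc n * k)) * r ^ (Suc n * k))
     = bohr_majorant k \<alpha> r"
proof -
  interpret starlike_logarithms k \<alpha> "extremal_A k \<alpha>" "extremal_B k \<alpha>" "\<lambda>s. s"
    by (rule extremal_starlike_logarithms[OF k \<alpha>])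
  note form = extremal_exp_form[of k \<alpha>]
  define s where "s = r ^ k"
  have z: "of_real r \<in> unit_disc" using r by simp
  have s: "0 \<le> s" "s < 1" using r k by (auto simp: s_def power_less_one_iff)
  have zk: "of_real r ^ k = (of_real s :: complex)" by (simp add: s_def)
  have pow: "r ^ (Suc n * k) = s ^ Suc n" for n
    unfolding s_def by (metis power_mult mult.commute)
  have "extremal_A k \<alpha> (of_real s) + extremal_B k \<alpha> (of_real s) = of_real (growth_exponent k \<alpha> s)"
    using s Ln_of_real[of "1 - s"] unfolding extremal_A_def extremal_B_def growth_exponent_def
    by (simp add: add_divide_distrib[symmetric] algebra_simps)
  then have nf: "norm (extremal k \<alpha> (of_real r)) = r * exp (growth_exponent k \<alpha> s)"
    using exp_form_norm[OF form z] r unfolding zk by simp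
  have "norm ((1 + of_real (1 - 2 * \<alpha>) * of_real s) / (1 - of_real s)\<^sup>2 :: complex) = (1 + (1 - 2 * \<alpha>) * s) / (1 - s)\<^sup>2"
  proof -
    have "(1 + of_real (1 - 2 * \<alpha>) * of_real s) / (1 - of_real s)\<^sup>2 = (of_real ((1 + (1 - 2 * \<alpha>) * s) / (1 - s)\<^sup>2) :: complex)"
      by simp
    moreover have "0 \<le> (1 + (1 - 2 * \<alpha>) * s) / (1 - s)\<^sup>2"
      unfolding majorant_factor_eq[OF s(2)] using s \<alpha> by auto
    ultimately show ?thesis by (simp only: norm_of_real abs_of_nonneg)
  qed
  moreover have "norm (of_real s :: complex) < 1" using s by simp
  ultimately have 1: "norm (of_real r * wirtinger_z (extremal k \<alpha>) (of_real r))
      = r * exp (growth_exponent k \<alpha> s) * ((1 + (1 - 2 * \<alpha>) * s) / (1 - s)\<^sup>2)"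
    unfolding wirtinger_exp_form(2)[OF k A(1) B(1) form z] norm_mult nf zk
    by (simp only: extremal_deriv_eq[OF k])
  have "norm (extremal_a k \<alpha> (Suc n * k) + exp (\<i> * of_real 0) * extremal_b k \<alpha> (Suc n * k))
      = (4 * (1 - \<alpha>) + 2 * \<alpha> / Suc n) / k" for n
  proof -
    have dv: "Suc n * k div k = Suc n" using k by simp
    have "extremal_a k \<alpha> (Suc n * k) + exp (\<i> * of_real 0) * extremal_b k \<alpha> (Suc n * k)
        = of_real ((4 * (1 - \<alpha>) + 2 * \<alpha> / Suc n) / k)"
      unfolding extremal_a_def extremal_b_def dv
      by (simp add: add_divide_distrib diff_divide_distrib del: of_nat_Suc)
    moreover have "0 \<le> (4 * (1 - \<alpha>) + 2 * \<alpha> / Suc n) / k" using \<alpha> by simp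
    ultimately show ?thesis by (simp only: norm_of_real abs_of_nonneg)
  qed
  then have 2: "(\<Sum>n. norm (extremal_a k \<alpha> (Suc n * k) + exp (\<i> * of_real 0) * extremal_b k \<alpha> (Suc n * k)) * r ^ (Suc n * k))
      = growth_exponent k \<alpha> s"
    using growth_exponent_sums[OF s, of \<alpha> k] by (simp only: pow sums_iff)
  show ?thesis
    unfolding 1 2 bohr_majorant_def s_def[symmetric] by (simp add: distrib_left)
qed

theorem theorem10:
  fixes k :: nat and \<alpha> :: real
  assumes "k \<ge> 1" and "0 \<le> \<alpha>" and "\<alpha> < 1"
  shows "\<exists>r\<^sub>6. (0 < r\<^sub>6 \<and> r\<^sub>6 < 1 \<and> radius_function k \<alpha> r\<^sub>6 = 1)
           \<and> (\<forall>r. 0 < r \<and> r < 1 \<and> radius_function k \<alpha> r = 1 \<longrightarrow> r = r\<^sub>6)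
           \<and> bohr_inequality_up_to k \<alpha> r\<^sub>6
           \<and> (\<forall>\<rho>>r\<^sub>6. \<not> bohr_inequality_up_to k \<alpha> \<rho>)"
proof -
  have root: "radius_function k \<alpha> r = 1 \<longleftrightarrow> bohr_majorant k \<alpha> r = covering_radius k \<alpha>" if "0 \<le> r" "r < 1" for r
    using radius_function_conv_majorant[OF assms(1) that, of \<alpha>] covering_radius_pos[of k \<alpha>]
    by (metis less_irrefl mult.right_neutral mult_left_cancel)
  have mono: "bohr_majorant k \<alpha> r < bohr_majorant k \<alpha> t" if "0 \<le> r" "r < t" "t < 1" for r t
    using bohr_majorant_strict_mono[OF assms that] .
  obtain r\<^sub>6 where r: "0 < r\<^sub>6" "r\<^sub>6 < 1" "bohr_majorant k \<alpha> r\<^sub>6 = covering_radius k \<alpha>"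
    using bohr_majorant_root[OF assms] .
  have unique: "r = r\<^sub>6" if "0 < r" "r < 1" "bohr_majorant k \<alpha> r = covering_radius k \<alpha>" for r
    using mono[of r r\<^sub>6] mono[of r\<^sub>6 r] that r by (cases r r\<^sub>6 rule: linorder_cases) auto
  have "bohr_inequality_up_to k \<alpha> r\<^sub>6"
    unfolding bohr_inequality_up_to_def
  proof (intro allI impI ballI)
    fix f h g a b \<omega> \<theta> z
    assume *: "f \<in> starlike_logharmonic k \<alpha> \<and> logharmonic_representation k f h g a b \<and> second_dilatation f \<omega> \<and> \<omega> 0 = 0"
      and z: "z \<in> unit_disc" "norm z \<le> r\<^sub>6"
    have "bohr_majorant k \<alpha> (norm z) \<le> covering_radius k \<alpha>"
      using mono[of "norm z" r\<^sub>6] z r by (cases "norm z = r\<^sub>6") auto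
    then show "bohr_inequality k f a b \<theta> z"
      using * z(1) by (intro bohr_inequality_of_majorant[OF assms, where \<omega> = \<omega> and g = g and h = h]) auto
  qed
  moreover have "\<not> bohr_inequality_up_to k \<alpha> \<rho>" if \<rho>: "r\<^sub>6 < \<rho>" for \<rho>
  proof
    assume up: "bohr_inequality_up_to k \<alpha> \<rho>"
    \<comment> \<open>The radius \<open>\<rho>\<close> may exceed 1, while the inequality is tested
      only inside the disc; hence the minimum with 1.\<close>
    obtain t where t: "r\<^sub>6 < t" "t < min \<rho> 1" using dense[of r\<^sub>6 "min \<rho> 1"] \<rho> r by auto
    have t0: "0 \<le> t" "t < 1" using t r by auto
    then have "of_real t \<in> unit_disc" "norm (of_real t :: complex) \<le> \<rho>" using t by auto
    moreover have "(0::complex) ^ k = 0" using assms(1) by simp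
    ultimately have "bohr_inequality k (extremal k \<alpha>) (extremal_a k \<alpha>) (extremal_b k \<alpha>) 0 (of_real t)"
      using up extremal_mem[OF assms] extremal_representation[OF assms]
      unfolding bohr_inequality_up_to_def by blast
    then have "bohr_majorant k \<alpha> t \<le> covering_radius k \<alpha>"
      using extremal_bohr_sum[OF assms t0] extremal_infdist_le[OF assms] t0
      unfolding bohr_inequality_def by simp
    then show False
      using mono[of r\<^sub>6 t] r t0 t by simp
  qed
  moreover have "radius_function k \<alpha> r\<^sub>6 = 1"
    using root[of r\<^sub>6] r by simp
  moreover have "\<forall>r. 0 < r \<and> r < 1 \<and> radius_function k \<alpha> r = 1 \<longrightarrow> r = r\<^sub>6"
    using root unique by (meson less_imp_le)
  ultimately show ?thesis
    using r(1,2) by blast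
qed

end
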